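(* Let $R$ denote the countable universal graph. (i) Let $\Gamma$ be a countable graph. Then there exist $2^{\aleph_0}$ distinct regular $\mathscr{D}$-classes of $\operatorname{End} R$ whose group $\mathscr{H}$-classes are isomorphic to $\operatorname{Aut}\Gamma$. (ii) Every regular $\mathscr{D}$-class of $\operatorname{End} R$ contains $2^{\aleph_0}$ distinct group $\mathscr{H}$-classes.
   Context: A graph is a pair $(V,E)$ with $E$ an irreflexive symmetric binary relation on the non-empty set $V$. The countable universal graph $R$ (random/Rado graph) is the Fraïssé limit of the class of finite graphs, equivalently the unique countable existentially closed graph: for any disjoint finite vertex sets $A,B$ there is a vertex adjacent to all of $A$ and none of $B$. $\operatorname{End} R$ is the monoid of endomorphisms (maps $V\to V$ sending edges to edges), with maps written on the right and $fg$ meaning first $f$ then $g$. Green's relations on a monoid $M$: $f\,\mathscr{L}\,g$ iff $Mf=Mg$; $f\,\mathscr{R}\,g$ iff $fM=gM$; $\mathscr{H}=\mathscr{L}\cap\mathscr{R}$; $\mathscr{D}=\mathscr{L}\circ\mathscr{R}$. An element $f$ is regular if $fgf=f$ for some $g\in M$; a regular $\mathscr{D}$-class is one consisting of regular elements. A group $\mathscr{H}$-class is the $\mathscr{H}$-class of an idempotent; it is a subgroup of $M$ (these are exactly the maximal subgroups). *)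

theory Defs
  imports "HOL-Algebra.Coset" "HOL-Library.Equipollence" "HOL-Library.Countable_Set"
begin

definition graph :: "'a set \<Rightarrow> ('a \<times> 'a) set \<Rightarrow> bool" where
  "graph V E \<longleftrightarrow> V \<noteq> {} \<and> E \<subseteq> V \<times> V \<and> irrefl E \<and> sym E"

definition existentially_closed :: "'a set \<Rightarrow> ('a \<times> 'a) set \<Rightarrow> bool" where
  "existentially_closed V E \<longleftrightarrow>
    (\<forall>A B. finite A \<and> finite B \<and> A \<subseteq> V \<and> B \<subseteq> V \<and> A \<inter> B = {} \<longrightarrow>
      (\<exists>v\<in>V. (\<forall>a\<in>A. (v, a) \<in> E) \<and> (\<forall>b\<in>B. (v, b) \<notin> E)))"

text \<open>The countable universal graph is determined only up to isomorphism, so it is given by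
  the property characterising it. Such a graph is automatically infinite.\<close>

definition countable_universal_graph :: "'a set \<Rightarrow> ('a \<times> 'a) set \<Rightarrow> bool" where
  "countable_universal_graph V E \<longleftrightarrow> graph V E \<and> countable V \<and> existentially_closed V E"

text \<open>Maps are written on the right: in the products below the left factor is applied first.
  Maps on \<open>V\<close> are taken extensional, so that equality of functions is equality on \<open>V\<close>.\<close>

definition End_graph :: "'a set \<Rightarrow> ('a \<times> 'a) set \<Rightarrow> ('a \<Rightarrow> 'a) monoid" where
  "End_graph V E =
    \<lparr>carrier = {f \<in> V \<rightarrow>\<^sub>E V. \<forall>x\<in>V. \<forall>y\<in>V. (x, y) \<in> E \<longrightarrow> (f x, f y) \<in> E},
     mult = (\<lambda>f g. compose V g f),
     one = (\<lambda>x\<in>V. x)\<rparr>"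

definition Aut_graph :: "'a set \<Rightarrow> ('a \<times> 'a) set \<Rightarrow> ('a \<Rightarrow> 'a) monoid" where
  "Aut_graph V E =
    \<lparr>carrier = {f \<in> extensional V. bij_betw f V V \<and>
       (\<forall>x\<in>V. \<forall>y\<in>V. (x, y) \<in> E \<longleftrightarrow> (f x, f y) \<in> E)},
     mult = (\<lambda>f g. compose V g f),
     one = (\<lambda>x\<in>V. x)\<rparr>"

definition green_L :: "('a, 'm) monoid_scheme \<Rightarrow> 'a rel" where
  "green_L M = {(f, g). f \<in> carrier M \<and> g \<in> carrier M \<and>
     carrier M #>\<^bsub>M\<^esub> f = carrier M #>\<^bsub>M\<^esub> g}"

definition green_R :: "('a, 'm) monoid_scheme \<Rightarrow> 'a rel" where
  "green_R M = {(f, g). f \<in> carrier M \<and> g \<in> carrier M \<and>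
     f <#\<^bsub>M\<^esub> carrier M = g <#\<^bsub>M\<^esub> carrier M}"

definition green_H :: "('a, 'm) monoid_scheme \<Rightarrow> 'a rel" where
  "green_H M = green_L M \<inter> green_R M"

definition green_D :: "('a, 'm) monoid_scheme \<Rightarrow> 'a rel" where
  "green_D M = green_L M O green_R M"

definition regular_element :: "('a, 'm) monoid_scheme \<Rightarrow> 'a \<Rightarrow> bool" where
  "regular_element M f \<longleftrightarrow> f \<in> carrier M \<and> (\<exists>g\<in>carrier M. f \<otimes>\<^bsub>M\<^esub> g \<otimes>\<^bsub>M\<^esub> f = f)"

definition regular_D_classes :: "('a, 'm) monoid_scheme \<Rightarrow> 'a set set" where
  "regular_D_classes M = {D \<in> carrier M // green_D M. \<forall>f\<in>D. regular_element M f}"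

definition idempotent_element :: "('a, 'm) monoid_scheme \<Rightarrow> 'a \<Rightarrow> bool" where
  "idempotent_element M e \<longleftrightarrow> e \<in> carrier M \<and> e \<otimes>\<^bsub>M\<^esub> e = e"

definition group_H_classes :: "('a, 'm) monoid_scheme \<Rightarrow> 'a set set" where
  "group_H_classes M = {green_H M `` {e} | e. idempotent_element M e}"

text \<open>The group structure on the \<open>\<H>\<close>-class of an idempotent \<open>e\<close>: the product is that of \<open>M\<close>,
  but the identity is \<open>e\<close>, which is in general not the identity of \<open>M\<close>.\<close>

definition H_group :: "('a, 'm) monoid_scheme \<Rightarrow> 'a \<Rightarrow> ('a, 'm) monoid_scheme" where
  "H_group M e = M\<lparr>carrier := green_H M `` {e}, one := e\<rparr>"

end

theory Submission
  imports Defs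
begin

text \<open>
  The group \<open>\<H>\<close>-class of an idempotent \<open>e\<close> is the automorphism group of the graph induced on
  the image of \<open>e\<close>, and idempotents in one \<open>\<D>\<close>-class have isomorphic images. The images of
  idempotents are algebraically closed: any finite set of their vertices has a common neighbour.
  Conversely, a countable algebraically closed graph embeds in \<open>R\<close> so that every vertex outside
  the image \<open>J\<close> has finitely many neighbours in \<open>J\<close>. A retraction onto \<open>J\<close> is then defined one
  vertex at a time, with at least two choices at each vertex outside \<open>J\<close>, so there are
  \<open>2\<^sup>\<aleph>\<^sup>0\<close> of them. They are \<open>\<L>\<close>-related, and distinct idempotents are never \<open>\<H>\<close>-related.

  For the first part, take the complement of the disjoint union of \<open>\<Gamma>\<close> with a comb, that is,
  a ray with leaves attached at the positions in a set \<open>S\<close>. This complement is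
  algebraically closed. Combs are rigid and \<open>S\<close> can be read off them, and only countably many
  of them are components of \<open>\<Gamma>\<close>; for all other \<open>S\<close> the automorphism group is that of \<open>\<Gamma>\<close>.
\<close>

section \<open>Green's relations\<close>

context monoid
begin

text \<open>The identity places \<open>f\<close> in its own coset, so inclusion of principal left
  ideals is divisibility on the left. Later arguments work with the multipliers \<open>a\<close> and
  \<open>b\<close> alone.\<close>

lemma green_L_iff:
  "(f, g) \<in> green_L G \<longleftrightarrow> f \<in> carrier G \<and> g \<in> carrier G \<and>
     (\<exists>a\<in>carrier G. f = a \<otimes> g) \<and> (\<exists>b\<in>carrier G. g = b \<otimes> f)"
proof -
  have incl: "carrier G #> f \<subseteq> carrier G #> g \<longleftrightarrow> (\<exists>a\<in>carrier G. f = a \<otimes> g)"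
    if fg: "f \<in> carrier G" "g \<in> carrier G" for f g
  proof
    have "f \<in> carrier G #> f"
      using fg by (force simp: r_coset_def intro: bexI[of _ \<one>])
    moreover assume "carrier G #> f \<subseteq> carrier G #> g"
    ultimately show "\<exists>a\<in>carrier G. f = a \<otimes> g"
      by (auto simp: r_coset_def)
  next
    assume "\<exists>a\<in>carrier G. f = a \<otimes> g"
    then obtain a where a: "a \<in> carrier G" "f = a \<otimes> g" ..
    have "h \<otimes> f \<in> carrier G #> g" if "h \<in> carrier G" for h
      using that fg a(1) unfolding a(2) r_coset_def
      by (auto simp: m_assoc[symmetric] intro!: bexI[of _ "h \<otimes> a"])
    then show "carrier G #> f \<subseteq> carrier G #> g"
      by (auto simp: r_coset_def)
  qed
  show ?thesis
    using incl unfolding green_L_def set_eq_subset by auto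
qed

lemma green_R_iff:
  "(f, g) \<in> green_R G \<longleftrightarrow> f \<in> carrier G \<and> g \<in> carrier G \<and>
     (\<exists>a\<in>carrier G. f = g \<otimes> a) \<and> (\<exists>b\<in>carrier G. g = f \<otimes> b)"
proof -
  have incl: "f <# carrier G \<subseteq> g <# carrier G \<longleftrightarrow> (\<exists>a\<in>carrier G. f = g \<otimes> a)"
    if fg: "f \<in> carrier G" "g \<in> carrier G" for f g
  proof
    have "f \<in> f <# carrier G"
      using fg by (force simp: l_coset_def intro: bexI[of _ \<one>])
    moreover assume "f <# carrier G \<subseteq> g <# carrier G"
    ultimately show "\<exists>a\<in>carrier G. f = g \<otimes> a"
      by (auto simp: l_coset_def)
  next
    assume "\<exists>a\<in>carrier G. f = g \<otimes> a"
    then obtain a where a: "a \<in> carrier G" "f = g \<otimes> a" ..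
    have "f \<otimes> h \<in> g <# carrier G" if "h \<in> carrier G" for h
      using that fg a(1) unfolding a(2) l_coset_def
      by (auto simp: m_assoc intro!: bexI[of _ "a \<otimes> h"])
    then show "f <# carrier G \<subseteq> g <# carrier G"
      by (auto simp: l_coset_def)
  qed
  show ?thesis
    using incl unfolding green_R_def set_eq_subset by auto
qed

lemma green_refl:
  assumes "f \<in> carrier G"
  shows "(f, f) \<in> green_L G" "(f, f) \<in> green_R G" "(f, f) \<in> green_H G" "(f, f) \<in> green_D G"
  using assms by (auto simp: green_L_def green_R_def green_H_def green_D_def)

text \<open>Both elements equal \<open>e \<otimes> f\<close>: the \<L>-relation makes
  \<open>f\<close> act as an identity on the right of \<open>e\<close>, and the \<R>-relation makes
  \<open>e\<close> act as one on the left of \<open>f\<close>.\<close>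

lemma idempotent_green_H_unique:
  assumes "idempotent_element G e" "idempotent_element G f" "(e, f) \<in> green_H G"
  shows "e = f"
proof -
  have e: "e \<in> carrier G" "e \<otimes> e = e" and f: "f \<in> carrier G" "f \<otimes> f = f"
    using assms by (auto simp: idempotent_element_def)
  have "(e, f) \<in> green_L G" "(e, f) \<in> green_R G"
    using assms by (auto simp: green_H_def)
  then obtain a b where a: "a \<in> carrier G" "e = a \<otimes> f" and b: "b \<in> carrier G" "f = e \<otimes> b"
    by (auto simp: green_L_iff green_R_iff)
  have "e \<otimes> f = e" using a f m_assoc by metis
  moreover have "e \<otimes> f = f" using b e m_assoc by metis
  ultimately show ?thesis by simp
qed

text \<open>If \<open>f \<otimes> g \<otimes> f = f\<close>, then \<open>g \<otimes> f\<close> is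
  idempotent, and each of \<open>f\<close> and \<open>g \<otimes> f\<close> is a left multiple of
  the other.\<close>

lemma regular_element_green_L_idempotent:
  assumes "regular_element G f"
  obtains e where "idempotent_element G e" "(f, e) \<in> green_L G"
proof -
  obtain g where f: "f \<in> carrier G" and g: "g \<in> carrier G" and fgf: "f \<otimes> g \<otimes> f = f"
    using assms by (auto simp: regular_element_def)
  have "idempotent_element G (g \<otimes> f)"
    using f g fgf by (simp add: idempotent_element_def m_assoc)
  moreover have "(f, g \<otimes> f) \<in> green_L G"
    using f g fgf unfolding green_L_iff by (metis m_assoc m_closed)
  ultimately show ?thesis using that by blast
qed

text \<open>The multipliers supply an inverse of \<open>f\<close>. In the proof's notation,
  \<open>f \<otimes> c = h\<close>, \<open>a \<otimes> h = e\<close> and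
  \<open>h \<otimes> e = h\<close>, so multiplying \<open>c \<otimes> a\<close> by
  \<open>f = h \<otimes> d\<close> on both sides gives
  \<open>h \<otimes> e \<otimes> d = f\<close>.\<close>

lemma regular_element_green_D_idempotent:
  assumes "idempotent_element G e" "(e, f) \<in> green_D G"
  shows "regular_element G f"
proof -
  have e: "e \<in> carrier G" "e \<otimes> e = e" using assms by (auto simp: idempotent_element_def)
  obtain h where "(e, h) \<in> green_L G" "(h, f) \<in> green_R G"
    using assms by (auto simp: green_D_def)
  then obtain a b c d where h: "h \<in> carrier G" and f: "f \<in> carrier G"
    and a: "a \<in> carrier G" "e = a \<otimes> h" and b: "b \<in> carrier G" "h = b \<otimes> e"
    and c: "c \<in> carrier G" "h = f \<otimes> c" and d: "d \<in> carrier G" "f = h \<otimes> d"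
    unfolding green_L_iff green_R_iff by blast
  have he: "h \<otimes> e = h" using b e m_assoc by metis
  have "f \<otimes> (c \<otimes> a) \<otimes> f = ((f \<otimes> c) \<otimes> (a \<otimes> h)) \<otimes> d"
    using f c(1) a(1) d(1) h by (simp add: m_assoc d(2)[symmetric])
  also have "\<dots> = f" using a(2) c(2) he d(2) by metis
  finally show ?thesis
    using f a c unfolding regular_element_def by (meson m_closed)
qed

end

section \<open>Retractions and their images\<close>

text \<open>Only edges between vertices of the two given sets are compared. The induced subgraph on
  a subset \<open>J\<close> of \<open>V\<close> can thus be given as \<open>J\<close> with the full
  relation \<open>E\<close>.\<close>

definition graph_isomorphism ::
  "'a set \<Rightarrow> ('a \<times> 'a) set \<Rightarrow> 'b set \<Rightarrow> ('b \<times> 'b) set \<Rightarrow> ('a \<Rightarrow> 'b) \<Rightarrow> bool" where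
  "graph_isomorphism V E W F \<phi> \<longleftrightarrow>
     bij_betw \<phi> V W \<and> (\<forall>x\<in>V. \<forall>y\<in>V. (x, y) \<in> E \<longleftrightarrow> (\<phi> x, \<phi> y) \<in> F)"

lemma graph_isomorphism_inv_into:
  assumes "graph_isomorphism V E W F \<phi>"
  shows "graph_isomorphism W F V E (inv_into V \<phi>)"
proof -
  have bij: "bij_betw \<phi> V W" and edge: "\<forall>x\<in>V. \<forall>y\<in>V. (x, y) \<in> E \<longleftrightarrow> (\<phi> x, \<phi> y) \<in> F"
    using assms by (auto simp: graph_isomorphism_def)
  have "bij_betw (inv_into V \<phi>) W V" using bij by (rule bij_betw_inv_into)
  moreover have "(x, y) \<in> F \<longleftrightarrow> (inv_into V \<phi> x, inv_into V \<phi> y) \<in> E"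
    if "x \<in> W" "y \<in> W" for x y
  proof -
    have "inv_into V \<phi> x \<in> V" "inv_into V \<phi> y \<in> V"
      using calculation that by (auto simp: bij_betw_def)
    then show ?thesis
      using edge that bij bij_betw_inv_into_right by metis
  qed
  ultimately show ?thesis by (auto simp: graph_isomorphism_def)
qed

lemma graph_isomorphism_comp:
  assumes "graph_isomorphism V E W F \<phi>" "graph_isomorphism W F U D \<psi>"
  shows "graph_isomorphism V E U D (\<psi> \<circ> \<phi>)"
  using assms by (auto simp: graph_isomorphism_def intro: bij_betw_trans dest: bij_betwE)

section \<open>Automorphism groups of isomorphic graphs\<close>

lemma carrier_Aut_graph_iff:
  "f \<in> carrier (Aut_graph V E) \<longleftrightarrow> f \<in> extensional V \<and> graph_isomorphism V E V E f"
  by (auto simp: Aut_graph_def graph_isomorphism_def)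

lemma mult_Aut_graph: "f \<otimes>\<^bsub>Aut_graph V E\<^esub> g = compose V g f"
  by (simp add: Aut_graph_def)

text \<open>Conjugation by \<phi>, restricted to \<open>W\<close> so as to be extensional, is a
  group isomorphism; \<open>k\<close> conjugates back.\<close>

lemma Aut_graph_isomorphic:
  assumes "graph_isomorphism V E W F \<phi>"
  shows "Aut_graph V E \<cong> Aut_graph W F"
proof -
  define \<psi> where "\<psi> = inv_into V \<phi>"
  have \<psi>: "graph_isomorphism W F V E \<psi>"
    using assms by (simp add: \<psi>_def graph_isomorphism_inv_into)
  have bij: "bij_betw \<phi> V W" "bij_betw \<psi> W V"
    using assms \<psi> by (auto simp: graph_isomorphism_def)
  have inv1: "\<psi> (\<phi> x) = x" if "x \<in> V" for x
    using bij that by (simp add: \<psi>_def bij_betw_inv_into_left)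
  have inv2: "\<phi> (\<psi> x) = x" if "x \<in> W" for x
    using bij that by (simp add: \<psi>_def bij_betw_inv_into_right)
  have mem: "x \<in> V \<Longrightarrow> \<phi> x \<in> W" "y \<in> W \<Longrightarrow> \<psi> y \<in> V" for x y
    using bij by (auto dest: bij_betwE)
  define h where "h f = (\<lambda>y\<in>W. \<phi> (f (\<psi> y)))" for f
  define k where "k g = (\<lambda>x\<in>V. \<psi> (g (\<phi> x)))" for g
  have restr: "graph_isomorphism A X B Y (\<lambda>x\<in>A. u x) \<longleftrightarrow> graph_isomorphism A X B Y u"
    for A B and X :: "('c \<times> 'c) set" and Y :: "('d \<times> 'd) set" and u
    by (simp add: graph_isomorphism_def cong: bij_betw_cong)
  have hc: "h f \<in> carrier (Aut_graph W F)" if "f \<in> carrier (Aut_graph V E)" for f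
  proof -
    have "graph_isomorphism W F W F (\<phi> \<circ> (f \<circ> \<psi>))"
      using that assms \<psi> by (auto simp: carrier_Aut_graph_iff intro: graph_isomorphism_comp)
    then show ?thesis by (simp add: carrier_Aut_graph_iff h_def restr comp_def)
  qed
  have kc: "k g \<in> carrier (Aut_graph V E)" if "g \<in> carrier (Aut_graph W F)" for g
  proof -
    have "graph_isomorphism V E V E (\<psi> \<circ> (g \<circ> \<phi>))"
      using that assms \<psi> by (auto simp: carrier_Aut_graph_iff intro: graph_isomorphism_comp)
    then show ?thesis by (simp add: carrier_Aut_graph_iff k_def restr comp_def)
  qed
  have selfmap: "f x \<in> V" if "f \<in> carrier (Aut_graph V E)" "x \<in> V" for f x
    using that by (auto simp: carrier_Aut_graph_iff graph_isomorphism_def dest: bij_betwE)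
  have selfmap': "f x \<in> W" if "f \<in> carrier (Aut_graph W F)" "x \<in> W" for f x
    using that by (auto simp: carrier_Aut_graph_iff graph_isomorphism_def dest: bij_betwE)
  have kh: "k (h f) = f" if f: "f \<in> carrier (Aut_graph V E)" for f
  proof (rule extensionalityI[of _ V])
    show "f \<in> extensional V" using f by (simp add: carrier_Aut_graph_iff)
    show "k (h f) x = f x" if "x \<in> V" for x
      using that f by (simp add: k_def h_def mem inv1 selfmap)
  qed (simp add: k_def)
  have hk: "h (k g) = g" if g: "g \<in> carrier (Aut_graph W F)" for g
  proof (rule extensionalityI[of _ W])
    show "g \<in> extensional W" using g by (simp add: carrier_Aut_graph_iff)
    show "h (k g) x = g x" if "x \<in> W" for x
      using that g by (simp add: k_def h_def mem inv2 selfmap')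
  qed (simp add: h_def)
  have "bij_betw h (carrier (Aut_graph V E)) (carrier (Aut_graph W F))"
    by (rule bij_betw_byWitness[where f' = k]) (use hc kc kh hk in auto)
  moreover have "h (f \<otimes>\<^bsub>Aut_graph V E\<^esub> g) = h f \<otimes>\<^bsub>Aut_graph W F\<^esub> h g"
    if "f \<in> carrier (Aut_graph V E)" "g \<in> carrier (Aut_graph V E)" for f g
    unfolding mult_Aut_graph
    by (rule ext) (use that in \<open>simp add: h_def compose_def mem inv1 selfmap\<close>)
  ultimately have "h \<in> iso (Aut_graph V E) (Aut_graph W F)"
    using hc by (auto simp: iso_def hom_def)
  then show ?thesis by (rule is_isoI)
qed

section \<open>The endomorphism monoid and Green's relations on it\<close>

lemma carrier_End_graph_iff:
  "f \<in> carrier (End_graph V E) \<longleftrightarrow>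
     f \<in> V \<rightarrow>\<^sub>E V \<and> (\<forall>x\<in>V. \<forall>y\<in>V. (x, y) \<in> E \<longrightarrow> (f x, f y) \<in> E)"
  by (simp add: End_graph_def)

lemma mult_End_graph: "f \<otimes>\<^bsub>End_graph V E\<^esub> g = compose V g f"
  by (simp add: End_graph_def)

lemma mult_End_graph_apply: "x \<in> V \<Longrightarrow> (f \<otimes>\<^bsub>End_graph V E\<^esub> g) x = g (f x)"
  by (simp add: mult_End_graph compose_eq)

lemma End_graph_apply_closed: "f \<in> carrier (End_graph V E) \<Longrightarrow> x \<in> V \<Longrightarrow> f x \<in> V"
  by (auto simp: carrier_End_graph_iff)

lemma End_graph_edge:
  "f \<in> carrier (End_graph V E) \<Longrightarrow> x \<in> V \<Longrightarrow> y \<in> V \<Longrightarrow> (x, y) \<in> E \<Longrightarrow> (f x, f y) \<in> E"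
  by (auto simp: carrier_End_graph_iff)

lemma monoid_End_graph: "monoid (End_graph V E)"
proof
  show "\<And>x y. x \<in> carrier (End_graph V E) \<Longrightarrow> y \<in> carrier (End_graph V E) \<Longrightarrow>
        x \<otimes>\<^bsub>End_graph V E\<^esub> y \<in> carrier (End_graph V E)"
    by (auto simp: End_graph_def compose_def) (meson PiE_mem)
  show "\<And>x y z. x \<in> carrier (End_graph V E) \<Longrightarrow> y \<in> carrier (End_graph V E) \<Longrightarrow>
        z \<in> carrier (End_graph V E) \<Longrightarrow>
        x \<otimes>\<^bsub>End_graph V E\<^esub> y \<otimes>\<^bsub>End_graph V E\<^esub> z = x \<otimes>\<^bsub>End_graph V E\<^esub> (y \<otimes>\<^bsub>End_graph V E\<^esub> z)"
    by (auto simp: End_graph_def compose_def fun_eq_iff)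
  show "\<one>\<^bsub>End_graph V E\<^esub> \<in> carrier (End_graph V E)"
    by (auto simp: End_graph_def)
  show "\<And>x. x \<in> carrier (End_graph V E) \<Longrightarrow> \<one>\<^bsub>End_graph V E\<^esub> \<otimes>\<^bsub>End_graph V E\<^esub> x = x"
       "\<And>x. x \<in> carrier (End_graph V E) \<Longrightarrow> x \<otimes>\<^bsub>End_graph V E\<^esub> \<one>\<^bsub>End_graph V E\<^esub> = x"
    by (auto simp: End_graph_def compose_def fun_eq_iff PiE_def extensional_def Pi_def)
qed

lemma End_graph_eqI:
  assumes "f \<in> carrier (End_graph V E)" "g \<in> carrier (End_graph V E)" "\<And>x. x \<in> V \<Longrightarrow> f x = g x"
  shows "f = g"
  using assms by (auto simp: carrier_End_graph_iff intro: PiE_ext)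

lemma idempotent_End_graph_iff:
  "idempotent_element (End_graph V E) e \<longleftrightarrow>
     e \<in> carrier (End_graph V E) \<and> (\<forall>x\<in>V. e (e x) = e x)"
proof -
  interpret monoid "End_graph V E" by (rule monoid_End_graph)
  show ?thesis
    unfolding idempotent_element_def
    by (metis End_graph_eqI mult_End_graph_apply m_closed)
qed

text \<open>Maps are written on the right, so in \<open>f = a \<otimes> g\<close> the map
  \<open>g\<close> is applied last and the image of \<open>f\<close> lies in that of
  \<open>g\<close>.\<close>

lemma green_L_End_graphD:
  assumes "(f, g) \<in> green_L (End_graph V E)"
  shows "f ` V = g ` V"
proof -
  interpret monoid "End_graph V E" by (rule monoid_End_graph)
  have "f ` V \<subseteq> g ` V" if fg: "(f, g) \<in> green_L (End_graph V E)" for f g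
  proof -
    obtain a where "a \<in> carrier (End_graph V E)" "f = a \<otimes>\<^bsub>End_graph V E\<^esub> g"
      using fg[unfolded green_L_iff] by (elim conjE bexE)
    then show ?thesis by (auto simp: mult_End_graph_apply End_graph_apply_closed)
  qed
  moreover have "(g, f) \<in> green_L (End_graph V E)"
    using assms by (auto simp: green_L_def)
  ultimately show ?thesis using assms by blast
qed

text \<open>The right multipliers \<open>a\<close> and \<open>b\<close> carry \<open>g x\<close> to
  \<open>f x\<close> and back. Hence they are mutually inverse between the images, and both preserve
  edges.\<close>

lemma green_R_End_graph_image_isomorphism:
  assumes "(f, g) \<in> green_R (End_graph V E)"
  obtains \<phi> where "graph_isomorphism (f ` V) E (g ` V) E \<phi>" "\<forall>x\<in>V. g x = \<phi> (f x)"
proof -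
  interpret monoid "End_graph V E" by (rule monoid_End_graph)
  obtain a b where ab: "a \<in> carrier (End_graph V E)" "b \<in> carrier (End_graph V E)"
    and fg: "f \<in> carrier (End_graph V E)" "g \<in> carrier (End_graph V E)"
    and eq: "f = g \<otimes>\<^bsub>End_graph V E\<^esub> a" "g = f \<otimes>\<^bsub>End_graph V E\<^esub> b"
    using assms unfolding green_R_iff by blast
  have f: "f x = a (g x)" and g: "g x = b (f x)" if "x \<in> V" for x
    using eq that mult_End_graph_apply by metis+
  have "bij_betw b (f ` V) (g ` V)"
    by (rule bij_betw_byWitness[where f' = a]) (auto simp: f[symmetric] g[symmetric])
  moreover have "(f x, f y) \<in> E \<longleftrightarrow> (b (f x), b (f y)) \<in> E" if "x \<in> V" "y \<in> V" for x y
  proof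
    assume "(f x, f y) \<in> E"
    then show "(b (f x), b (f y)) \<in> E"
      using End_graph_edge ab fg that End_graph_apply_closed by metis
  next
    assume "(b (f x), b (f y)) \<in> E"
    then have "(a (g x), a (g y)) \<in> E"
      using End_graph_edge[OF ab(1)] fg that End_graph_apply_closed g by metis
    then show "(f x, f y) \<in> E" using f that by simp
  qed
  ultimately have "graph_isomorphism (f ` V) E (g ` V) E b"
    by (auto simp: graph_isomorphism_def)
  then show ?thesis using that g by blast
qed

lemma green_D_End_graph_image_isomorphism:
  assumes "(f, g) \<in> green_D (End_graph V E)"
  obtains \<phi> where "graph_isomorphism (f ` V) E (g ` V) E \<phi>"
proof -
  obtain h where "(f, h) \<in> green_L (End_graph V E)" "(h, g) \<in> green_R (End_graph V E)"
    using assms by (auto simp: green_D_def)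
  then show ?thesis
    using that green_R_End_graph_image_isomorphism green_L_End_graphD by metis
qed

lemma comp_isomorphism_End_graph:
  assumes "e \<in> carrier (End_graph V E)" "graph_isomorphism (e ` V) E J E \<phi>" "J \<subseteq> V"
  shows "(\<lambda>x\<in>V. \<phi> (e x)) \<in> carrier (End_graph V E)"
  using assms unfolding carrier_End_graph_iff graph_isomorphism_def
  by (auto dest!: bij_betwE)

text \<open>With \<open>h\<close> as \<phi> after \<open>f\<close>, and \<open>k\<close> as the
  inverse of \<phi> after \<open>e\<close>, one has \<open>e = k \<otimes> h\<close>,
  \<open>h = h \<otimes> e\<close>, \<open>f = h \<otimes> k\<close> and
  \<open>h = f \<otimes> h\<close>, because idempotents fix their images. The linking element is
  kept explicit: for \<open>f = e\<close> it describes the \<H>-class of \<open>e\<close>.\<close>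

lemma idempotents_green_D:
  assumes e: "idempotent_element (End_graph V E) e" and f: "idempotent_element (End_graph V E) f"
    and iso: "graph_isomorphism (f ` V) E (e ` V) E \<phi>"
  shows "(e, \<lambda>x\<in>V. \<phi> (f x)) \<in> green_L (End_graph V E)"
    and "(\<lambda>x\<in>V. \<phi> (f x), f) \<in> green_R (End_graph V E)"
proof -
  interpret monoid "End_graph V E" by (rule monoid_End_graph)
  have ec: "e \<in> carrier (End_graph V E)" "\<And>x. x \<in> V \<Longrightarrow> e (e x) = e x"
    and fc: "f \<in> carrier (End_graph V E)" "\<And>x. x \<in> V \<Longrightarrow> f (f x) = f x"
    using e f by (auto simp: idempotent_End_graph_iff)
  have sub: "e ` V \<subseteq> V" "f ` V \<subseteq> V"
    using End_graph_apply_closed[OF ec(1)] End_graph_apply_closed[OF fc(1)] by auto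
  define \<psi> where "\<psi> = inv_into (f ` V) \<phi>"
  have iso': "graph_isomorphism (e ` V) E (f ` V) E \<psi>"
    unfolding \<psi>_def by (rule graph_isomorphism_inv_into) (rule iso)
  have bij: "bij_betw \<phi> (f ` V) (e ` V)" using iso by (simp add: graph_isomorphism_def)
  define h k where "h = (\<lambda>x\<in>V. \<phi> (f x))" and "k = (\<lambda>x\<in>V. \<psi> (e x))"
  have hk: "h \<in> carrier (End_graph V E)" "k \<in> carrier (End_graph V E)"
    unfolding h_def k_def using comp_isomorphism_End_graph iso iso' sub ec(1) fc(1) by blast+
  have \<phi>: "\<phi> (f x) \<in> e ` V" "\<psi> (\<phi> (f x)) = f x" if "x \<in> V" for x
    using bij that by (auto simp: \<psi>_def bij_betw_inv_into_left dest: bij_betwE)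
  have \<psi>: "\<psi> (e x) \<in> f ` V" "\<phi> (\<psi> (e x)) = e x" if "x \<in> V" for x
    using bij that iso' by (auto simp: \<psi>_def bij_betw_inv_into_right graph_isomorphism_def dest: bij_betwE)
  have fixe: "e y = y" if "y \<in> e ` V" for y using that ec by auto
  have fixf: "f y = y" if "y \<in> f ` V" for y using that fc by auto
  have "e = k \<otimes>\<^bsub>End_graph V E\<^esub> h"
  proof (rule End_graph_eqI[of _ V E])
    show "e x = (k \<otimes>\<^bsub>End_graph V E\<^esub> h) x" if "x \<in> V" for x
      using that subsetD[OF sub(2) \<psi>(1)[OF that]]
      by (simp add: mult_End_graph_apply h_def k_def fixf[OF \<psi>(1)] \<psi>(2))
  qed (use ec(1) hk in auto)
  moreover have "h = h \<otimes>\<^bsub>End_graph V E\<^esub> e"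
  proof (rule End_graph_eqI[of _ V E])
    show "h x = (h \<otimes>\<^bsub>End_graph V E\<^esub> e) x" if "x \<in> V" for x
      using that by (simp add: mult_End_graph_apply h_def fixe[OF \<phi>(1)])
  qed (use ec(1) hk in auto)
  ultimately show "(e, \<lambda>x\<in>V. \<phi> (f x)) \<in> green_L (End_graph V E)"
    unfolding green_L_iff h_def[symmetric] using ec(1) hk by blast
  have "f = h \<otimes>\<^bsub>End_graph V E\<^esub> k"
  proof (rule End_graph_eqI[of _ V E])
    show "f x = (h \<otimes>\<^bsub>End_graph V E\<^esub> k) x" if "x \<in> V" for x
      using that subsetD[OF sub(1) \<phi>(1)[OF that]]
      by (simp add: mult_End_graph_apply h_def k_def fixe[OF \<phi>(1)] \<phi>(2))
  qed (use fc(1) hk in auto)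
  moreover have "h = f \<otimes>\<^bsub>End_graph V E\<^esub> h"
  proof (rule End_graph_eqI[of _ V E])
    show "h x = (f \<otimes>\<^bsub>End_graph V E\<^esub> h) x" if "x \<in> V" for x
      using that fc End_graph_apply_closed[OF fc(1)] by (simp add: mult_End_graph_apply h_def)
  qed (use fc(1) hk in auto)
  ultimately show "(\<lambda>x\<in>V. \<phi> (f x), f) \<in> green_R (End_graph V E)"
    unfolding green_R_iff h_def[symmetric] using fc(1) hk by blast
qed

text \<open>Restriction to the image of \<open>e\<close> is inverted by precomposition with
  \<open>e\<close>. A member \<open>g\<close> of the class satisfies \<open>g (e x) = g x\<close>,
  so its values on the image determine it.\<close>

lemma H_group_End_graph_isomorphic:
  assumes e: "idempotent_element (End_graph V E) e"
  shows "H_group (End_graph V E) e \<cong> Aut_graph (e ` V) E"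
proof -
  interpret monoid "End_graph V E" by (rule monoid_End_graph)
  let ?M = "End_graph V E"
  have ec: "e \<in> carrier ?M" "\<And>x. x \<in> V \<Longrightarrow> e (e x) = e x"
    using e by (auto simp: idempotent_End_graph_iff)
  have sub: "e ` V \<subseteq> V" using End_graph_apply_closed[OF ec(1)] by auto
  have fixe: "e y = y" if "y \<in> e ` V" for y using that ec by auto
  define r where "r g = restrict g (e ` V)" for g :: "'a \<Rightarrow> 'a"
  define k where "k \<alpha> = (\<lambda>x\<in>V. \<alpha> (e x))" for \<alpha> :: "'a \<Rightarrow> 'a"
  have H: "g \<in> carrier ?M" "g ` V = e ` V" "\<forall>x\<in>V. g (e x) = g x"
      "r g \<in> carrier (Aut_graph (e ` V) E)" if "(e, g) \<in> green_H ?M" for g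
  proof -
    have L: "(e, g) \<in> green_L ?M" and R: "(e, g) \<in> green_R ?M" using that by (auto simp: green_H_def)
    show "g \<in> carrier ?M" using L by (simp add: green_L_def)
    show im: "g ` V = e ` V" using green_L_End_graphD[OF L] by simp
    obtain \<phi> where \<phi>: "graph_isomorphism (e ` V) E (g ` V) E \<phi>" "\<forall>x\<in>V. g x = \<phi> (e x)"
      using green_R_End_graph_image_isomorphism[OF R] by metis
    show ge: "\<forall>x\<in>V. g (e x) = g x"
      using \<phi>(2) ec sub by (metis image_subset_iff)
    have "\<forall>y\<in>e ` V. r g y = \<phi> y"
      using \<phi>(2) ge by (simp add: r_def)
    moreover from this have "bij_betw (r g) (e ` V) (e ` V) \<longleftrightarrow> bij_betw \<phi> (e ` V) (e ` V)"
      by (intro bij_betw_cong) blast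
    ultimately show "r g \<in> carrier (Aut_graph (e ` V) E)"
      using \<phi>(1) im by (simp add: carrier_Aut_graph_iff graph_isomorphism_def) (simp add: r_def)
  qed
  have K: "(e, k \<alpha>) \<in> green_H ?M" "r (k \<alpha>) = \<alpha>" if "\<alpha> \<in> carrier (Aut_graph (e ` V) E)" for \<alpha>
  proof -
    have iso: "graph_isomorphism (e ` V) E (e ` V) E \<alpha>" and ext: "\<alpha> \<in> extensional (e ` V)"
      using that by (auto simp: carrier_Aut_graph_iff)
    then show "(e, k \<alpha>) \<in> green_H ?M"
      using idempotents_green_D[OF e e iso] by (auto simp: k_def green_H_def green_R_def)
    show "r (k \<alpha>) = \<alpha>"
      using ext sub by (intro extensionalityI[of _ "e ` V"]) (auto simp: r_def k_def ec)
  qed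
  have "k (r g) = g" if "(e, g) \<in> green_H ?M" for g
    using H[OF that] by (intro extensionalityI[of _ V]) (auto simp: r_def k_def carrier_End_graph_iff PiE_def)
  then have "bij_betw r (carrier (H_group ?M e)) (carrier (Aut_graph (e ` V) E))"
    using H K by (intro bij_betw_byWitness[where f' = k]) (auto simp: H_group_def)
  moreover have "r (f \<otimes>\<^bsub>?M\<^esub> g) = r f \<otimes>\<^bsub>Aut_graph (e ` V) E\<^esub> r g" if "(e, f) \<in> green_H ?M" for f g
    unfolding mult_Aut_graph mult_End_graph
    using H(2)[OF that] sub by (auto simp: r_def compose_def fun_eq_iff)
  ultimately have "r \<in> iso (H_group ?M e) (Aut_graph (e ` V) E)"
    using H(4) by (auto simp: iso_def hom_def H_group_def)
  then show ?thesis by (rule is_isoI)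
qed

section \<open>Algebraically closed graphs as retracts\<close>

definition algebraically_closed :: "'a set \<Rightarrow> ('a \<times> 'a) set \<Rightarrow> bool" where
  "algebraically_closed W F \<longleftrightarrow>
     (\<forall>A. finite A \<and> A \<subseteq> W \<longrightarrow> (\<exists>w\<in>W. \<forall>a\<in>A. (w, a) \<in> F))"

text \<open>A common neighbour of all vertices would be adjacent to itself.\<close>

lemma algebraically_closed_infinite:
  assumes "graph W F" "algebraically_closed W F"
  shows "infinite W"
proof
  assume "finite W"
  then obtain w where "w \<in> W" "(w, w) \<in> F"
    using assms(2) unfolding algebraically_closed_def by blast
  then show False using assms(1) by (auto simp: graph_def irrefl_def)
qed

text \<open>Irreflexivity keeps \<open>v\<close> out of \<open>A\<close>. To keep it out of
  \<open>B\<close>, it is also made adjacent to a vertex \<open>z2\<close> that has no neighbour in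
  \<open>B\<close>. That \<open>z2\<close> lies outside \<open>A\<close> and \<open>B\<close> is
  ensured by \<open>z1\<close>, which is adjacent to all of them but not to
  \<open>z2\<close>.\<close>

lemma existentially_closed_fresh:
  assumes g: "graph V E" and ec: "existentially_closed V E"
    and AB: "finite A" "finite B" "A \<subseteq> V" "B \<subseteq> V" "A \<inter> B = {}"
  obtains v where "v \<in> V" "v \<notin> A" "v \<notin> B" "\<forall>a\<in>A. (v, a) \<in> E" "\<forall>b\<in>B. (v, b) \<notin> E"
proof -
  have ex: "\<exists>v\<in>V. (\<forall>a\<in>A. (v, a) \<in> E) \<and> (\<forall>b\<in>B. (v, b) \<notin> E)"
    if "finite A" "finite B" "A \<subseteq> V" "B \<subseteq> V" "A \<inter> B = {}" for A B
    using ec that unfolding existentially_closed_def by blast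
  have sym: "(x, y) \<in> E \<Longrightarrow> (y, x) \<in> E" and irr: "(x, x) \<notin> E" for x y
    using g by (auto simp: graph_def sym_def irrefl_def)
  obtain z1 where z1: "z1 \<in> V" "\<forall>a\<in>A \<union> B. (z1, a) \<in> E"
    using ex[of "A \<union> B" "{}"] AB by auto
  obtain z2 where z2: "z2 \<in> V" "\<forall>b\<in>insert z1 (A \<union> B). (z2, b) \<notin> E"
    using ex[of "{}" "insert z1 (A \<union> B)"] AB z1 by auto
  have "z2 \<notin> A \<union> B" using z1 z2 sym by blast
  then obtain v where v: "v \<in> V" "\<forall>a\<in>insert z2 A. (v, a) \<in> E" "\<forall>b\<in>B. (v, b) \<notin> E"
    using ex[of "insert z2 A" B] AB z2 by auto
  have "v \<notin> B" using v(2) z2 sym by blast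
  moreover have "v \<notin> A" using v(2) irr by blast
  ultimately show ?thesis using that v by blast
qed

lemma countable_universal_graph_infinite:
  assumes "countable_universal_graph V E"
  shows "infinite V"
proof
  assume "finite V"
  moreover have "graph V E" "existentially_closed V E"
    using assms by (auto simp: countable_universal_graph_def)
  ultimately show False
    using existentially_closed_fresh[of V E "{}" V] by auto
qed

text \<open>A common neighbour in \<open>V\<close> of vertices of the image is sent by
  \<open>e\<close> to a common neighbour in the image, since \<open>e\<close> fixes those
  vertices.\<close>

lemma retract_algebraically_closed:
  assumes "countable_universal_graph V E" "idempotent_element (End_graph V E) e"
  shows "graph (e ` V) (E \<inter> (e ` V) \<times> (e ` V))"
    and "algebraically_closed (e ` V) (E \<inter> (e ` V) \<times> (e ` V))"
proof -
  have g: "graph V E" and ec: "existentially_closed V E"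
    using assms by (auto simp: countable_universal_graph_def)
  have e: "e \<in> carrier (End_graph V E)" "\<And>x. x \<in> V \<Longrightarrow> e (e x) = e x"
    using assms by (auto simp: idempotent_End_graph_iff)
  show "graph (e ` V) (E \<inter> (e ` V) \<times> (e ` V))"
    using g by (auto simp: graph_def irrefl_def sym_def)
  show "algebraically_closed (e ` V) (E \<inter> (e ` V) \<times> (e ` V))"
    unfolding algebraically_closed_def
  proof (intro allI impI)
    fix A assume A: "finite A \<and> A \<subseteq> e ` V"
    then have AV: "A \<subseteq> V" using End_graph_apply_closed[OF e(1)] by auto
    then obtain v where v: "v \<in> V" "\<forall>a\<in>A. (v, a) \<in> E"
      using ec A unfolding existentially_closed_def by (metis finite.emptyI empty_subsetI inf_bot_right)
    have "(e v, a) \<in> E" if "a \<in> A" for a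
    proof -
      have "e a = a" using that A e(2) by auto
      then show ?thesis using End_graph_edge[OF e(1) v(1), of a] that v AV by auto
    qed
    then show "\<exists>w\<in>e ` V. \<forall>a\<in>A. (w, a) \<in> E \<inter> (e ` V) \<times> (e ` V)"
      using v A by blast
  qed
qed

text \<open>The embedding of \<open>W\<close> is built so that the image of the \<open>n\<close>-th vertex is not adjacent to
  any of the first \<open>n\<close> vertices of \<open>V\<close> outside the image. Hence each vertex outside the image
  has only finitely many neighbours in it.\<close>

lemma thin_embedding:
  fixes d :: "nat \<Rightarrow> 'b" and v :: "nat \<Rightarrow> 'a"
  assumes g: "graph V E" and ec: "existentially_closed V E" and vV: "range v \<subseteq> V"
    and F: "sym F" "irrefl F"
  obtains \<iota> where "inj \<iota>" "range \<iota> \<subseteq> V" "v 0 \<notin> range \<iota>"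
    "\<And>m n. (\<iota> m, \<iota> n) \<in> E \<longleftrightarrow> (d m, d n) \<in> F"
    "\<And>k n. v k \<notin> range \<iota> \<Longrightarrow> k \<le> n \<Longrightarrow> (v k, \<iota> n) \<notin> E"
proof -
  have sym: "(x, y) \<in> E \<Longrightarrow> (y, x) \<in> E" and irr: "(x, x) \<notin> E" for x y
    using g by (auto simp: graph_def sym_def irrefl_def)
  have symF: "(x, y) \<in> F \<Longrightarrow> (y, x) \<in> F" and irrF: "(x, x) \<notin> F" for x y
    using F by (auto simp: sym_def irrefl_def)
  define A where "A n \<iota> = {\<iota> m |m. m < n \<and> (d m, d n) \<in> F}" for n :: nat and \<iota> :: "nat \<Rightarrow> 'a"
  \<comment> \<open>The bound \<open>{..n}\<close> includes \<open>v n\<close>, and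
    \<open>v 0\<close> is avoided at every stage. Subtracting \<open>A n \<iota>\<close> makes the
    two sets disjoint; vertices outside the image are never subtracted.\<close>
  define B where "B n \<iota> = (v ` {..n} \<union> \<iota> ` {..<n}) - A n \<iota>" for n :: nat and \<iota> :: "nat \<Rightarrow> 'a"
  define P where "P \<iota> n x \<longleftrightarrow> x \<in> V \<and> x \<notin> A n \<iota> \<and> x \<notin> B n \<iota> \<and>
      (\<forall>a\<in>A n \<iota>. (x, a) \<in> E) \<and> (\<forall>b\<in>B n \<iota>. (x, b) \<notin> E)" for \<iota> n x
  have "\<exists>\<iota>. \<forall>n. P \<iota> n (\<iota> n)"
  proof (rule dependent_wellorder_choice)
    fix r and \<iota> \<iota>' :: "nat \<Rightarrow> 'a" and n :: nat
    assume *: "\<And>m. m < n \<Longrightarrow> \<iota> m = \<iota>' m"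
    have "A n \<iota> = A n \<iota>'" unfolding A_def using * by metis
    moreover have "\<iota> ` {..<n} = \<iota>' ` {..<n}" using * by auto
    ultimately have "B n \<iota> = B n \<iota>'" by (simp add: B_def)
    with \<open>A n \<iota> = A n \<iota>'\<close> show "P \<iota> n r = P \<iota>' n r" by (simp add: P_def)
  next
    fix n :: nat and \<iota> :: "nat \<Rightarrow> 'a"
    assume *: "\<And>m. m < n \<Longrightarrow> P \<iota> m (\<iota> m)"
    have iV: "\<iota> m \<in> V" if "m < n" for m using *[OF that] by (simp add: P_def)
    have A: "A n \<iota> \<subseteq> \<iota> ` {..<n}" by (auto simp: A_def)
    then have "finite (A n \<iota>)" "finite (B n \<iota>)" "A n \<iota> \<subseteq> V" "B n \<iota> \<subseteq> V" "A n \<iota> \<inter> B n \<iota> = {}"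
      using vV iV by (auto simp: B_def intro: finite_subset)
    then show "\<exists>x. P \<iota> n x"
      using existentially_closed_fresh[OF g ec] unfolding P_def by metis
  qed
  then obtain \<iota> where \<iota>: "\<And>n. P \<iota> n (\<iota> n)" by blast
  have new: "\<iota> n \<notin> v ` {..n}" "\<iota> n \<notin> \<iota> ` {..<n}" for n
    using \<iota>[of n] by (auto simp: P_def B_def)
  have inj: "inj \<iota>"
    by (rule linorder_injI) (use new in \<open>metis imageI lessThan_iff\<close>)
  have less: "(\<iota> n, \<iota> m) \<in> E \<longleftrightarrow> (d n, d m) \<in> F" if "m < n" for m n
  proof (cases "(d m, d n) \<in> F")
    case True
    then have "\<iota> m \<in> A n \<iota>" using that by (auto simp: A_def)
    then show ?thesis using \<iota>[of n] True symF by (auto simp: P_def)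
  next
    case False
    \<comment> \<open>Injectivity prevents \<open>\<iota> m\<close> from entering
      \<open>A n \<iota>\<close> through another index.\<close>
    then have "\<iota> m \<notin> A n \<iota>" using inj by (auto simp: A_def inj_eq)
    then have "\<iota> m \<in> B n \<iota>" using that by (auto simp: B_def)
    then show ?thesis using \<iota>[of n] False symF by (auto simp: P_def)
  qed
  show ?thesis
  proof
    show "inj \<iota>" by (rule inj)
    show "range \<iota> \<subseteq> V" using \<iota> by (auto simp: P_def)
    show "v 0 \<notin> range \<iota>" using new(1) by (metis atMost_iff image_eqI le0 rangeE)
    show "(\<iota> m, \<iota> n) \<in> E \<longleftrightarrow> (d m, d n) \<in> F" for m n
      using less[of m n] less[of n m] sym symF irr irrF by (metis linorder_neqE_nat)
    show "(v k, \<iota> n) \<notin> E" if "v k \<notin> range \<iota>" "k \<le> n" for k n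
    proof -
      have "v k \<in> B n \<iota>" using that by (auto simp: A_def B_def)
      then show ?thesis using \<iota>[of n] sym by (auto simp: P_def)
    qed
  qed
qed

text \<open>The second vertex is taken adjacent to the first as well, and therefore differs from
  it.\<close>

lemma algebraically_closed_two_choices:
  assumes "graph W F" "algebraically_closed W F" "finite A" "A \<subseteq> W"
  shows "\<exists>w w'. w \<in> W \<and> w' \<in> W \<and> w \<noteq> w' \<and> (\<forall>a\<in>A. (w, a) \<in> F \<and> (w', a) \<in> F)"
proof -
  have ac: "\<exists>w\<in>W. \<forall>a\<in>A. (w, a) \<in> F" if "finite A" "A \<subseteq> W" for A
    using assms(2) that by (simp add: algebraically_closed_def)
  obtain w where w: "w \<in> W" "\<forall>a\<in>A. (w, a) \<in> F" using ac assms by blast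
  obtain w' where w': "w' \<in> W" "\<forall>a\<in>insert w A. (w', a) \<in> F"
    using ac[of "insert w A"] assms w by blast
  have "w \<noteq> w'" using w' assms(1) by (auto simp: graph_def irrefl_def)
  then show ?thesis using w w' by blast
qed

text \<open>The value \<open>d 0\<close> is a dummy making the recursion terminate; it belongs to the set anyway.\<close>

fun greedy_sequence :: "('b set \<Rightarrow> bool \<Rightarrow> 'b) \<Rightarrow> (nat \<Rightarrow> 'b) \<Rightarrow> nat set \<Rightarrow> nat \<Rightarrow> 'b" where
  "greedy_sequence c d S n =
     c (d ` {..n} \<union> (\<lambda>m. if m < n then greedy_sequence c d S m else d 0) ` {..n}) (n \<in> S)"

declare greedy_sequence.simps [simp del]

text \<open>A vertex \<open>v n\<close> outside \<open>J\<close> goes to the image of the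
  \<open>n\<close>-th term of the greedy sequence, which is adjacent to \<open>d 0\<close>, ...,
  \<open>d n\<close> and to all earlier terms. Edges between outside vertices are then preserved,
  and so are edges into \<open>J\<close>, because by thinness the neighbours of \<open>v n\<close>
  in \<open>J\<close> have indices below \<open>n\<close>.\<close>

lemma many_retractions:
  fixes V :: "'a set" and W :: "'b set"
  assumes R: "countable_universal_graph V E"
    and W: "graph W F" "countable W" "algebraically_closed W F"
  obtains J \<iota> and \<rho> :: "nat set \<Rightarrow> 'a \<Rightarrow> 'a" where
    "J \<subseteq> V" "graph_isomorphism W F J E \<iota>" "inj \<rho>"
    "\<And>S. idempotent_element (End_graph V E) (\<rho> S)" "\<And>S. \<rho> S ` V = J"
proof -
  have g: "graph V E" and ec: "existentially_closed V E" and cV: "countable V"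
    using R by (auto simp: countable_universal_graph_def)
  have sym: "(x, y) \<in> E \<Longrightarrow> (y, x) \<in> E" and irr: "(x, x) \<notin> E" for x y
    using g by (auto simp: graph_def sym_def irrefl_def)
  have FW: "F \<subseteq> W \<times> W" "sym F" "irrefl F" using W by (auto simp: graph_def)
  have symF: "(x, y) \<in> F \<Longrightarrow> (y, x) \<in> F" for x y using FW by (auto simp: sym_def)
  define v where "v = from_nat_into V"
  have v: "bij_betw v UNIV V"
    unfolding v_def by (rule bij_betw_from_nat_into[OF cV countable_universal_graph_infinite[OF R]])
  define d where "d = from_nat_into W"
  have d: "bij_betw d UNIV W"
    unfolding d_def by (rule bij_betw_from_nat_into[OF W(2) algebraically_closed_infinite[OF W(1,3)]])
  have dW: "d n \<in> W" for n using d by (auto simp: bij_betw_def)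
  have vV: "v n \<in> V" for n using v by (auto simp: bij_betw_def)
  obtain j where j: "inj j" "range j \<subseteq> V" "v 0 \<notin> range j"
    and jE: "\<And>m n. (j m, j n) \<in> E \<longleftrightarrow> (d m, d n) \<in> F"
    and thin: "\<And>k n. v k \<notin> range j \<Longrightarrow> k \<le> n \<Longrightarrow> (v k, j n) \<notin> E"
    using thin_embedding[OF g ec, of v F d] vV FW by (metis image_subsetI)
  define J where "J = range j"
  define \<iota> where "\<iota> w = j (inv_into UNIV d w)" for w
  have \<iota>d: "\<iota> (d n) = j n" for n
    using d by (simp add: \<iota>_def bij_betw_def)
  have Wd: "w \<in> W \<longleftrightarrow> (\<exists>n. w = d n)" for w using d by (auto simp: bij_betw_def)
  have iso: "graph_isomorphism W F J E \<iota>"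
  proof -
    have "bij_betw \<iota> W J"
    proof (rule bij_betw_imageI)
      show "inj_on \<iota> W" using j(1) by (intro inj_onI) (metis Wd \<iota>d injD)
      have "W = range d" using d by (simp add: bij_betw_def)
      then show "\<iota> ` W = J" by (simp add: J_def image_image \<iota>d)
    qed
    then show ?thesis by (auto simp: graph_isomorphism_def \<iota>d Wd jE)
  qed
  define K where "K = {k. v k \<notin> J}"
  \<comment> \<open>Otherwise some vertex adjacent to \<open>v 0\<close> would avoid the finitely
    many vertices outside \<open>J\<close> and so lie in \<open>J\<close>; but thinness with
    \<open>k = 0\<close> leaves \<open>v 0\<close> without neighbours in \<open>J\<close>.\<close>
  have "infinite K"
  proof
    assume "finite K"
    define X where "X = v ` K - {v 0}"
    obtain x where x: "x \<in> V" "x \<notin> {v 0}" "x \<notin> X" "\<forall>a\<in>{v 0}. (x, a) \<in> E"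
      by (rule existentially_closed_fresh[OF g ec, of "{v 0}" X])
        (use \<open>finite K\<close> vV in \<open>auto simp: X_def\<close>)
    obtain k where k: "x = v k" using x v by (auto simp: bij_betw_def)
    have "x \<in> J" using x k by (auto simp: K_def X_def)
    then obtain n where "x = j n" by (auto simp: J_def)
    then show False using thin[of 0 n] j(3) x(4) sym by auto
  qed
  \<comment> \<open>The two choices are packed into one function on truth values, so that membership
    of \<open>n\<close> in \<open>S\<close> selects between them.\<close>
  define c where "c A = (SOME p. p True \<in> W \<and> p False \<in> W \<and> p True \<noteq> p False \<and>
      (\<forall>a\<in>A. (p True, a) \<in> F \<and> (p False, a) \<in> F))" for A :: "'b set"
  have c: "c A True \<in> W \<and> c A False \<in> W \<and> c A True \<noteq> c A False \<and>
      (\<forall>a\<in>A. (c A True, a) \<in> F \<and> (c A False, a) \<in> F)" if A: "finite A" "A \<subseteq> W" for A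
  proof -
    obtain w w' where "w \<in> W \<and> w' \<in> W \<and> w \<noteq> w' \<and> (\<forall>a\<in>A. (w, a) \<in> F \<and> (w', a) \<in> F)"
      using algebraically_closed_two_choices[OF W(1,3) A] by blast
    then have "\<exists>p. p True \<in> W \<and> p False \<in> W \<and> p True \<noteq> p False \<and>
      (\<forall>a\<in>A. (p True, a) \<in> F \<and> (p False, a) \<in> F)"
      by (intro exI[of _ "\<lambda>b. if b then w else w'"]) simp
    then show ?thesis unfolding c_def by (rule someI_ex)
  qed
  have cb: "c A b \<in> W" "\<forall>a\<in>A. (c A b, a) \<in> F" if "finite A" "A \<subseteq> W" for A b
    using c[OF that] by (cases b; auto)+
  define D where "D S n = d ` {..n} \<union> greedy_sequence c d S ` {..<n}" for S n
  have \<sigma>: "greedy_sequence c d S n = c (D S n) (n \<in> S)" for S n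
  proof -
    have "d ` {..n} \<union> (\<lambda>m. if m < n then greedy_sequence c d S m else d 0) ` {..n} = D S n"
      by (auto simp: D_def image_iff split: if_splits)
    then show ?thesis by (subst greedy_sequence.simps) simp
  qed
  have \<sigma>W: "greedy_sequence c d S n \<in> W" for S n
  proof (induction n rule: less_induct)
    case (less n)
    then show ?case unfolding \<sigma>[of S n] using dW by (intro cb(1)) (auto simp: D_def)
  qed
  have D: "finite (D S n)" "D S n \<subseteq> W" for S n
    using dW \<sigma>W by (auto simp: D_def)
  have \<sigma>d: "(greedy_sequence c d S n, d m) \<in> F" if "m \<le> n" for S m n
    unfolding \<sigma>[of S n] using cb(2)[OF D] that by (auto simp: D_def)
  have \<sigma>\<sigma>: "(greedy_sequence c d S n, greedy_sequence c d S m) \<in> F" if "m < n" for S m n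
    unfolding \<sigma>[of S n] using cb(2)[OF D] that by (auto simp: D_def)
  have \<iota>J: "\<iota> w \<in> J" if "w \<in> W" for w
    using iso that by (auto simp: graph_isomorphism_def dest: bij_betwE)
  have \<iota>E: "(x, y) \<in> F \<longleftrightarrow> (\<iota> x, \<iota> y) \<in> E" if "x \<in> W" "y \<in> W" for x y
    using iso that by (simp add: graph_isomorphism_def)
  define \<tau> where "\<tau> S x = (if x \<in> J then x else \<iota> (greedy_sequence c d S (inv_into UNIV v x)))" for S x
  have \<tau>v: "\<tau> S (v k) = \<iota> (greedy_sequence c d S k)" if "v k \<notin> J" for S k
    using v that by (simp add: \<tau>_def bij_betw_def)
  have \<tau>J: "\<tau> S x \<in> J" for S x by (simp add: \<tau>_def \<iota>J \<sigma>W)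
  have JV: "J \<subseteq> V" using j by (simp add: J_def)
  have cross: "(\<tau> S (v k), \<tau> S (j n)) \<in> E" if "v k \<notin> J" "(v k, j n) \<in> E" for S k n
  proof -
    have "n \<le> k" using thin[of k n] that by (auto simp: J_def)
    then have "(\<iota> (greedy_sequence c d S k), \<iota> (d n)) \<in> E"
      using \<sigma>d \<iota>E \<sigma>W dW by blast
    then show ?thesis using that by (simp add: \<tau>v \<iota>d) (simp add: \<tau>_def J_def)
  qed
  have out: "(\<tau> S (v k), \<tau> S (v l)) \<in> E" if "v k \<notin> J" "v l \<notin> J" "l < k" for S k l
    using that \<sigma>\<sigma> \<iota>E \<sigma>W by (simp add: \<tau>v)
  have hom: "(\<tau> S x, \<tau> S y) \<in> E" if xy: "x \<in> V" "y \<in> V" "(x, y) \<in> E" for S x y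
  proof -
    obtain k l where kl: "x = v k" "y = v l" using xy v by (auto simp: bij_betw_def)
    have "k \<noteq> l" using xy kl irr by blast
    show ?thesis
    proof (cases "x \<in> J"; cases "y \<in> J")
      assume "x \<in> J" "y \<in> J" then show ?thesis using xy by (simp add: \<tau>_def)
    next
      assume "x \<notin> J" "y \<in> J"
      then show ?thesis using cross[of k _ S] xy kl by (auto simp: J_def)
    next
      assume "x \<in> J" "y \<notin> J"
      then show ?thesis using cross[of l _ S] xy kl sym by (fastforce simp: J_def)
    next
      assume "x \<notin> J" "y \<notin> J"
      then show ?thesis using out[of k l S] out[of l k S] kl sym \<open>k \<noteq> l\<close> by (metis linorder_neqE_nat)
    qed
  qed
  \<comment> \<open>The choices are coded at indices in \<open>K\<close>, where the greedy sequence
    is visible in \<tau>; \<open>enumerate\<close> transfers arbitrary sets of naturals into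
    \<open>K\<close>.\<close>
  define \<rho> where "\<rho> S = (\<lambda>x\<in>V. \<tau> (enumerate K ` S) x)" for S
  have \<tau>id: "\<tau> S x = x" if "x \<in> J" for S x using that by (simp add: \<tau>_def)
  have \<tau>V: "\<tau> S x \<in> V" for S x using \<tau>J JV by blast
  have idem: "idempotent_element (End_graph V E) (\<rho> S)" for S
    unfolding idempotent_End_graph_iff carrier_End_graph_iff
    using hom by (auto simp: \<rho>_def \<tau>V \<tau>id \<tau>J)
  have im: "\<rho> S ` V = J" for S
  proof
    show "\<rho> S ` V \<subseteq> J" by (auto simp: \<rho>_def \<tau>J)
    have "\<rho> S x = x" if "x \<in> J" for x using that JV by (auto simp: \<rho>_def \<tau>id)
    then show "J \<subseteq> \<rho> S ` V" using JV by (metis image_eqI subsetD subsetI)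
  qed
  have inj\<tau>: "S = T" if ST: "S \<subseteq> K" "T \<subseteq> K" "\<forall>x\<in>V. \<tau> S x = \<tau> T x" for S T
  proof -
    have eq: "greedy_sequence c d S k = greedy_sequence c d T k" if "k \<in> K" for k
    proof -
      have "\<iota> (greedy_sequence c d S k) = \<iota> (greedy_sequence c d T k)"
        using bspec[OF ST(3) vV[of k]] that by (simp add: K_def \<tau>v)
      then show ?thesis using iso \<sigma>W unfolding graph_isomorphism_def bij_betw_def
        by (meson inj_onD)
    qed
    \<comment> \<open>Agreement below \<open>n\<close> gives equal constraint sets at
      \<open>n\<close>. For \<open>n\<close> in \<open>K\<close> the common value then reveals the
      choice made; outside \<open>K\<close> both sets omit \<open>n\<close>.\<close>
    have "greedy_sequence c d S n = greedy_sequence c d T n \<and> (n \<in> S \<longleftrightarrow> n \<in> T)" for n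
    proof (induction n rule: less_induct)
      case (less n)
      then have "greedy_sequence c d S ` {..<n} = greedy_sequence c d T ` {..<n}"
        by (intro image_cong) auto
      then have DD: "D S n = D T n" by (simp add: D_def)
      show ?case
      proof (cases "n \<in> K")
        case True
        have "c (D S n) (n \<in> S) = c (D S n) (n \<in> T)"
          using eq[OF True] \<sigma> DD by metis
        then have "n \<in> S \<longleftrightarrow> n \<in> T"
          using c[OF D, of S n] by (cases "n \<in> S"; cases "n \<in> T"; simp)
        then show ?thesis using eq[OF True] by simp
      next
        case False
        then have "n \<notin> S" "n \<notin> T" using ST by auto
        then show ?thesis using \<sigma> DD by simp
      qed
    qed
    then show ?thesis by blast
  qed
  have "inj \<rho>"
  proof (rule injI)
    fix S T assume "\<rho> S = \<rho> T"
    then have "\<forall>x\<in>V. \<tau> (enumerate K ` S) x = \<tau> (enumerate K ` T) x"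
      unfolding \<rho>_def by (metis restrict_apply')
    moreover have "enumerate K ` S \<subseteq> K" "enumerate K ` T \<subseteq> K"
      using enumerate_in_set[OF \<open>infinite K\<close>] by auto
    ultimately have "enumerate K ` S = enumerate K ` T" by (rule inj\<tau>[rotated 2])
    moreover have "inj (enumerate K)"
      using strict_mono_enumerate[OF \<open>infinite K\<close>] strict_mono_imp_inj_on by blast
    ultimately show "S = T" by (simp add: inj_image_eq_iff)
  qed
  then show ?thesis using that JV iso idem im by blast
qed

section \<open>Combs\<close>

text \<open>All neighbourhoods are prescribed exactly, so a comb is a whole connected component.\<close>

definition comb :: "('a \<times> 'a) set \<Rightarrow> nat set \<Rightarrow> (nat \<Rightarrow> 'a) \<Rightarrow> (nat \<Rightarrow> 'a) \<Rightarrow> bool" where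
  "comb F S r l \<longleftrightarrow> inj r \<and> (\<forall>m. \<forall>n\<in>S. r m \<noteq> l n) \<and> F `` {r 0} = {r 1} \<and>
     (\<forall>n. F `` {r (Suc n)} = {r n, r (Suc (Suc n))} \<union> (if Suc n \<in> S then {l (Suc n)} else {})) \<and>
     (\<forall>n\<in>S. F `` {l n} = {r n})"

lemma combD:
  assumes "comb F S r l"
  shows "inj r" "n \<in> S \<Longrightarrow> r m \<noteq> l n" "F `` {r 0} = {r 1}"
    "F `` {r (Suc n)} = {r n, r (Suc (Suc n))} \<union> (if Suc n \<in> S then {l (Suc n)} else {})"
    "n \<in> S \<Longrightarrow> F `` {l n} = {r n}"
  using assms unfolding comb_def by auto

text \<open>Beyond \<open>r n\<close>, the neighbours of \<open>r (Suc n)\<close> are the next ray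
  vertex and possibly a leaf. The leaf has \<open>r (Suc n)\<close> as its only neighbour, whereas
  the ray vertex has a further one. So \<open>F\<close> alone tells them apart.\<close>

lemma comb_next:
  assumes "comb F S r l"
  shows "{x \<in> F `` {r (Suc n)}. x \<noteq> r n \<and> F `` {x} \<noteq> {r (Suc n)}} = {r (Suc (Suc n))}"
    and "{x \<in> F `` {r (Suc n)}. x \<noteq> r n \<and> F `` {x} = {r (Suc n)}} =
           (if Suc n \<in> S then {l (Suc n)} else {})"
proof -
  note c = combD[OF assms]
  have "r (Suc (Suc (Suc n))) \<in> F `` {r (Suc (Suc n))}" by (simp add: c(4))
  moreover have "r (Suc (Suc (Suc n))) \<noteq> r (Suc n)" using c(1) by (simp add: inj_eq)
  ultimately have a: "F `` {r (Suc (Suc n))} \<noteq> {r (Suc n)}" by blast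
  have b: "r (Suc (Suc n)) \<noteq> r n" using c(1) by (simp add: inj_eq)
  have d: "l (Suc n) \<noteq> r n \<and> F `` {l (Suc n)} = {r (Suc n)}" if "Suc n \<in> S"
    using c(2)[OF that, of n] c(5)[OF that] by auto
  show "{x \<in> F `` {r (Suc n)}. x \<noteq> r n \<and> F `` {x} \<noteq> {r (Suc n)}} = {r (Suc (Suc n))}"
    "{x \<in> F `` {r (Suc n)}. x \<noteq> r n \<and> F `` {x} = {r (Suc n)}} =
           (if Suc n \<in> S then {l (Suc n)} else {})"
    unfolding c(4) using a b d by (auto split: if_splits)
qed

lemma comb_unique:
  assumes c: "comb F S r l" "comb F T r' l'" and start: "r 0 = r' 0" and "0 \<notin> S" "0 \<notin> T"
  shows "r = r'" "S = T" "n \<in> S \<Longrightarrow> l n = l' n"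
proof -
  \<comment> \<open>Two consecutive vertices are carried along, since the next one is recognised
    relative to its predecessor.\<close>
  have "r n = r' n \<and> r (Suc n) = r' (Suc n)" for n
  proof (induction n)
    case 0
    have "{r 1} = {r' 1}" using start combD(3)[OF c(1)] combD(3)[OF c(2)] by metis
    then show ?case using start by simp
  next
    case (Suc n)
    have "{r (Suc (Suc n))} = {r' (Suc (Suc n))}"
      using Suc comb_next(1)[OF c(1), of n] comb_next(1)[OF c(2), of n] by simp
    then show ?case using Suc by simp
  qed
  then show r: "r = r'" by blast
  have "(if Suc n \<in> S then {l (Suc n)} else {}) = (if Suc n \<in> T then {l' (Suc n)} else {})" for n
    using comb_next(2)[OF c(1), of n] comb_next(2)[OF c(2), of n] r by simp
  then have leaf: "(Suc n \<in> S \<longleftrightarrow> Suc n \<in> T) \<and> (Suc n \<in> S \<longrightarrow> l (Suc n) = l' (Suc n))" for n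
    by (metis empty_not_insert singleton_inject)
  then have "n \<in> S \<longleftrightarrow> n \<in> T" for n using assms by (cases n) auto
  then show "S = T" by blast
  show "l n = l' n" if "n \<in> S" using that leaf assms by (cases n) auto
qed

text \<open>The start of a comb has a single neighbour, so in another comb it can only be the start
  or a leaf. A leaf is excluded by degrees: as \<open>1 \<notin> T\<close>, the neighbour of
  \<open>r' 0\<close> has two neighbours, while the neighbour of a leaf has three.\<close>

lemma comb_start:
  assumes c: "comb F S r l" "comb F T r' l'" and "0 \<notin> S" "1 \<notin> T" "r' 0 \<in> range r \<union> l ` S"
  shows "r' 0 = r 0"
proof (rule ccontr)
  assume neq: "r' 0 \<noteq> r 0"
  note d = combD[OF c(1)] and d' = combD[OF c(2)]
  have N0: "F `` {r' 0} = {r' 1}" by (rule d'(3))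
  have N1: "F `` {r' 1} = {r' 0, r' 2}"
    using d'(4)[of 0] assms by (simp add: numeral_2_eq_2)
  consider n where "r' 0 = r (Suc n)" | n where "Suc n \<in> S" "r' 0 = l (Suc n)"
    using assms neq by (metis Un_iff imageE not0_implies_Suc)
  then show False
  proof cases
    case 1
    then have "r n \<in> {r' 1}" "r (Suc (Suc n)) \<in> {r' 1}" using N0 d(4)[of n] by auto
    then have "r n = r (Suc (Suc n))" by simp
    then show False using d(1) by (simp add: inj_eq)
  next
    case 2
    then have "r' 1 = r (Suc n)" using N0 d(5) by auto
    then have "{r' 0, r' 2} = {r n, r (Suc (Suc n)), l (Suc n)}"
      using N1 d(4)[of n] 2 by auto
    then have "r n \<in> {l (Suc n), r' 2}" "r (Suc (Suc n)) \<in> {l (Suc n), r' 2}"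
      using 2 by auto
    then have "r n = r (Suc (Suc n))" using d(2)[OF 2(1)] by auto
    then show False using d(1) by (simp add: inj_eq)
  qed
qed

text \<open>Since edges stay within the vertex sets, \<alpha> maps the full neighbourhood of a
  vertex onto the full neighbourhood of its image, and a comb is described by
  neighbourhoods.\<close>

lemma comb_image:
  assumes \<alpha>: "graph_isomorphism V E V' E' \<alpha>" and E: "E \<subseteq> V \<times> V" "E' \<subseteq> V' \<times> V'"
    and c: "comb E S r l" and V: "range r \<subseteq> V" "l ` S \<subseteq> V"
  shows "comb E' S (\<alpha> \<circ> r) (\<alpha> \<circ> l)"
proof -
  have bij: "inj_on \<alpha> V" "\<alpha> ` V = V'"
    and edge: "\<And>x y. x \<in> V \<Longrightarrow> y \<in> V \<Longrightarrow> (x, y) \<in> E \<longleftrightarrow> (\<alpha> x, \<alpha> y) \<in> E'"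
    using \<alpha> by (auto simp: graph_isomorphism_def bij_betw_def)
  have N: "E' `` {\<alpha> x} = \<alpha> ` (E `` {x})" if "x \<in> V" for x
    using E edge that bij(2) by blast
  note d = combD[OF c]
  have rV: "r n \<in> V" for n using V by auto
  have "inj (\<alpha> \<circ> r)" using d(1) bij(1) V(1) by (metis comp_inj_on inj_on_subset)
  moreover have "(\<alpha> \<circ> r) m \<noteq> (\<alpha> \<circ> l) n" if "n \<in> S" for m n
    using d(2)[OF that, of m] V that bij(1) rV by (auto dest: inj_onD)
  ultimately show ?thesis
    unfolding comb_def using V(2) by (auto simp: N rV d image_subset_iff)
qed

text \<open>By \<open>comb_unique\<close> the start vertex determines \<open>S\<close>, so choosing
  a start for each \<open>S\<close> gives an injection into \<open>W\<close>.\<close>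

lemma countable_combs:
  assumes "countable W" "F \<subseteq> W \<times> W"
  shows "countable {S. 0 \<notin> S \<and> (\<exists>r l. comb F S r l)}"
proof -
  define f where "f S = (SOME x. \<exists>r l. comb F S r l \<and> x = r 0)" for S
  have f: "\<exists>r l. comb F S r l \<and> f S = r 0" if "\<exists>r l. comb F S r l" for S
    unfolding f_def by (rule someI_ex) (use that in blast)
  have "inj_on f {S. 0 \<notin> S \<and> (\<exists>r l. comb F S r l)}"
  proof (rule inj_onI, clarify)
    fix S T r l r' l'
    assume *: "f S = f T" "0 \<notin> S" "comb F S r l" "0 \<notin> T" "comb F T r' l'"
    obtain r1 l1 where 1: "comb F S r1 l1" "f S = r1 0" using f[of S] *(3) by blast
    obtain r2 l2 where 2: "comb F T r2 l2" "f T = r2 0" using f[of T] *(5) by blast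
    show "S = T" by (rule comb_unique(2)[OF 1(1) 2(1)]) (use 1 2 * in auto)
  qed
  moreover have "f ` {S. 0 \<notin> S \<and> (\<exists>r l. comb F S r l)} \<subseteq> W"
  proof clarify
    fix S r l assume "comb F S r l"
    then obtain r l where c: "comb F S r l" "f S = r 0" using f[of S] by blast
    then have "(r 0, r 1) \<in> F" using combD(3)[OF c(1)] by auto
    then show "f S \<in> W" using assms c by auto
  qed
  ultimately show ?thesis
    using assms(1) by (meson countable_image_inj_on countable_subset)
qed

section \<open>Uncountably many combs absent from a countable graph\<close>

lemma uncountable_nat_set: "\<not> countable (UNIV :: nat set set)"
proof
  assume "countable (UNIV :: nat set set)"
  then have "range (from_nat_into (UNIV :: nat set set)) = Pow UNIV"
    by (simp add: range_from_nat_into)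
  then show False using Cantors_theorem by blast
qed

text \<open>Even numbers from 2 record \<open>A\<close> and odd numbers from 3 record
  \<open>B\<close>. Omitting 0 and 1 meets the side conditions of \<open>comb_unique\<close> and
  \<open>comb_start\<close>.\<close>

definition pair_code :: "nat set \<Rightarrow> nat set \<Rightarrow> nat set" where
  "pair_code A B = (\<lambda>n. 2 * n + 2) ` A \<union> (\<lambda>n. 2 * n + 3) ` B"

lemma pair_code_small: "0 \<notin> pair_code A B" "1 \<notin> pair_code A B"
  by (auto simp: pair_code_def)

lemma pair_code_eq_iff: "pair_code A B = pair_code A' B' \<longleftrightarrow> A = A' \<and> B = B'"
proof
  have "A = {n. 2 * n + 2 \<in> pair_code A B}" "B = {n. 2 * n + 3 \<in> pair_code A B}" for A B
    by (auto simp: pair_code_def) presburger+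
  then show "A = A' \<and> B = B'" if "pair_code A B = pair_code A' B'"
    using that by metis
qed simp

text \<open>Only countably many sets occur in combs of \<open>F\<close>. Coding pairs yields a family of size
  \<open>2\<^sup>\<aleph>\<^sup>0\<close> avoiding them without cardinal arithmetic.\<close>

lemma ex_combs_avoiding:
  assumes "countable W" "F \<subseteq> W \<times> W"
  obtains A where "\<And>B r l. \<not> comb F (pair_code A B) r l"
proof (rule ccontr)
  assume "\<not> thesis"
  \<comment> \<open>If each \<open>A\<close> had a bad partner \<open>b A\<close>, the codes of
    these pairs would be uncountably many comb sets of \<open>F\<close>. A good \<open>A\<close>
    leaves \<open>B\<close> free as a parameter.\<close>
  then have "\<forall>A. \<exists>B. \<exists>r l. comb F (pair_code A B) r l" using that by blast
  then obtain b where b: "\<And>A. \<exists>r l. comb F (pair_code A (b A)) r l" by metis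
  have "range (\<lambda>A. pair_code A (b A)) \<subseteq> {S. 0 \<notin> S \<and> (\<exists>r l. comb F S r l)}"
    using b pair_code_small by auto
  then have "countable (range (\<lambda>A. pair_code A (b A)))"
    using countable_combs[OF assms] countable_subset by blast
  moreover have "inj (\<lambda>A. pair_code A (b A))" by (simp add: inj_def pair_code_eq_iff)
  ultimately show False using uncountable_nat_set countable_image_inj_on by blast
qed

section \<open>Adding a comb to a graph\<close>

text \<open>\<open>Inr (n, False)\<close> is the ray vertex at position \<open>n\<close>, and
  \<open>Inr (n, True)\<close> is the leaf attached there.\<close>

definition comb_vertices :: "'b set \<Rightarrow> nat set \<Rightarrow> ('b + nat \<times> bool) set" where
  "comb_vertices W S = Inl ` W \<union> Inr ` (UNIV \<times> {False} \<union> S \<times> {True})"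

definition comb_edges :: "('b \<times> 'b) set \<Rightarrow> nat set \<Rightarrow> (('b + nat \<times> bool) \<times> ('b + nat \<times> bool)) set" where
  "comb_edges F S =
     {(Inl x, Inl y) |x y. (x, y) \<in> F} \<union>
     {(Inr (n, False), Inr (Suc n, False)) |n. True} \<union> {(Inr (Suc n, False), Inr (n, False)) |n. True} \<union>
     {(Inr (n, False), Inr (n, True)) |n. n \<in> S} \<union> {(Inr (n, True), Inr (n, False)) |n. n \<in> S}"

lemma comb_edges_sub: "F \<subseteq> W \<times> W \<Longrightarrow> comb_edges F S \<subseteq> comb_vertices W S \<times> comb_vertices W S"
  by (auto simp: comb_edges_def comb_vertices_def)

lemma comb_edges_sym: "sym F \<Longrightarrow> sym (comb_edges F S)"
  by (auto simp: comb_edges_def sym_def)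

lemma comb_edges_irrefl: "irrefl F \<Longrightarrow> irrefl (comb_edges F S)"
  by (auto simp: comb_edges_def irrefl_def)

lemma comb_edges_Inl: "comb_edges F S `` {Inl x} = Inl ` (F `` {x})"
  by (auto simp: comb_edges_def)

lemma comb_comb_edges:
  assumes "0 \<notin> S"
  shows "comb (comb_edges F S) S (\<lambda>n. Inr (n, False)) (\<lambda>n. Inr (n, True))"
  using assms unfolding comb_def comb_edges_def
  by (auto simp: inj_def)

text \<open>The image of the first comb is a comb in the second graph. It cannot lie in the part
  from \<open>W\<close>, where \<open>F\<close> has no such comb, so it starts inside the second
  comb. Then \<open>comb_start\<close> identifies the starts and \<open>comb_unique\<close>
  everything else.\<close>

lemma comb_edges_isomorphism:
  assumes F: "F \<subseteq> W \<times> W" and none: "\<And>r l. \<not> comb F S r l"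
    and S: "0 \<notin> S" "1 \<notin> S" and T: "0 \<notin> T"
    and \<alpha>: "graph_isomorphism (comb_vertices W S) (comb_edges F S) (comb_vertices W T) (comb_edges F T) \<alpha>"
  shows "S = T" "Inr p \<in> comb_vertices W S \<Longrightarrow> \<alpha> (Inr p) = Inr p"
proof -
  let ?r = "\<lambda>n. Inr (n, False) :: 'b + nat \<times> bool" and ?l = "\<lambda>n. Inr (n, True) :: 'b + nat \<times> bool"
  have c: "comb (comb_edges F T) S (\<alpha> \<circ> ?r) (\<alpha> \<circ> ?l)"
    by (rule comb_image[OF \<alpha> comb_edges_sub comb_edges_sub comb_comb_edges])
      (use F S in \<open>auto simp: comb_vertices_def\<close>)
  note d = combD[OF c, unfolded comp_def]
  have "\<alpha> (?r 0) \<notin> range Inl"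
  proof
    assume "\<alpha> (?r 0) \<in> range Inl"
    \<comment> \<open>No edge joins the two summands, so a comb starting in the left one stays there
      and projects to a comb of \<open>F\<close>.\<close>
    have step: "y \<in> range Inl" if xy: "x \<in> range Inl" "y \<in> comb_edges F T `` {x}" for x y
    proof -
      obtain a where a: "x = Inl a" using xy(1) by blast
      have "y \<in> Inl ` (F `` {a})" using xy(2) by (simp only: a comb_edges_Inl)
      then show ?thesis by blast
    qed
    have r: "\<alpha> (?r n) \<in> range Inl" for n
    proof (induction n)
      case 0 then show ?case by (rule \<open>\<alpha> (?r 0) \<in> range Inl\<close>)
    next
      case (Suc n)
      have "\<alpha> (?r (Suc n)) \<in> comb_edges F T `` {\<alpha> (?r n)}"
        by (cases n) (simp_all add: d(3,4))
      then show ?case using Suc step by blast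
    qed
    have l: "\<alpha> (?l n) \<in> range Inl" if n: "n \<in> S" for n
    proof -
      obtain m where m: "n = Suc m" using n S by (cases n) auto
      then have "\<alpha> (?l n) \<in> comb_edges F T `` {\<alpha> (?r n)}"
        using n by (simp add: d(4))
      then show ?thesis using r step by blast
    qed
    define r' l' where "r' n = projl (\<alpha> (?r n))" and "l' n = projl (\<alpha> (?l n))" for n
    have r': "\<alpha> (?r n) = Inl (r' n)" for n using r[of n] by (auto simp: r'_def)
    have l': "\<alpha> (?l n) = Inl (l' n)" if "n \<in> S" for n using l[OF that] by (auto simp: l'_def)
    have "comb F S r' l'"
      unfolding comb_def
    proof (intro conjI allI ballI)
      show "inj r'" using d(1) by (auto simp: r' inj_def)
      show "r' m \<noteq> l' n" if "n \<in> S" for m n using d(2)[OF that, of m] that by (simp add: r' l')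
      have inj: "Inl ` A = Inl ` B \<Longrightarrow> A = B" for A B :: "'b set"
        by (simp add: inj_image_eq_iff)
      show "F `` {r' 0} = {r' 1}"
        by (rule inj) (use d(3) in \<open>simp add: r' comb_edges_Inl\<close>)
      show "F `` {r' (Suc n)} = {r' n, r' (Suc (Suc n))} \<union> (if Suc n \<in> S then {l' (Suc n)} else {})" for n
        by (rule inj) (use d(4)[of n] in \<open>auto simp: r' l' comb_edges_Inl split: if_splits\<close>)
      show "F `` {l' n} = {r' n}" if "n \<in> S" for n
        by (rule inj) (use d(5)[OF that] that in \<open>simp add: r' l' comb_edges_Inl\<close>)
    qed
    then show False using none by blast
  qed
  moreover have "\<alpha> (?r 0) \<in> comb_vertices W T"
    using \<alpha> by (auto simp: graph_isomorphism_def comb_vertices_def dest!: bij_betwE)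
  ultimately have "(\<alpha> \<circ> ?r) 0 \<in> range ?r \<union> ?l ` T"
    by (auto simp: comb_vertices_def)
  note start = comb_start[OF comb_comb_edges[OF T] c T S(2) this]
  note u = comb_unique[OF c comb_comb_edges[OF T] start S(1) T]
  show "S = T" by (rule u(2))
  have "\<alpha> (?r n) = ?r n" for n using fun_cong[OF u(1), of n] by simp
  moreover have "\<alpha> (?l n) = ?l n" if "n \<in> S" for n using u(3)[OF that] by simp
  ultimately show "\<alpha> (Inr p) = Inr p" if "Inr p \<in> comb_vertices W S"
    using that by (auto simp: comb_vertices_def)
qed

section \<open>Complements of graphs with an added comb\<close>

definition complement_edges :: "'a set \<Rightarrow> ('a \<times> 'a) set \<Rightarrow> ('a \<times> 'a) set" where
  "complement_edges V E = {(x, y). x \<in> V \<and> y \<in> V \<and> x \<noteq> y \<and> (x, y) \<notin> E}"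

lemma graph_isomorphism_complement:
  assumes "irrefl E" "irrefl F"
  shows "graph_isomorphism V (complement_edges V E) W (complement_edges W F) \<alpha> \<longleftrightarrow>
         graph_isomorphism V E W F \<alpha>"
  unfolding graph_isomorphism_def
proof (intro conj_cong refl ball_cong)
  fix x y assume "bij_betw \<alpha> V W" "x \<in> V" "y \<in> V"
  then have "\<alpha> x \<in> W" "\<alpha> y \<in> W" "\<alpha> x = \<alpha> y \<longleftrightarrow> x = y"
    by (auto simp: bij_betw_def inj_on_def)
  then show "((x, y) \<in> complement_edges V E \<longleftrightarrow> (\<alpha> x, \<alpha> y) \<in> complement_edges W F) \<longleftrightarrow>
             ((x, y) \<in> E \<longleftrightarrow> (\<alpha> x, \<alpha> y) \<in> F)"
    using assms \<open>x \<in> V\<close> \<open>y \<in> V\<close> by (auto simp: complement_edges_def irrefl_def)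
qed

lemma complement_comb_graph:
  assumes "graph W F"
  shows "graph (comb_vertices W S) (complement_edges (comb_vertices W S) (comb_edges F S))"
proof -
  have "sym (comb_edges F S)" using assms by (simp add: graph_def comb_edges_sym)
  moreover have "comb_vertices W S \<noteq> {}" by (auto simp: comb_vertices_def)
  ultimately show ?thesis by (auto simp: graph_def complement_edges_def irrefl_def sym_def)
qed

lemma complement_comb_algebraically_closed:
  "algebraically_closed (comb_vertices W S) (complement_edges (comb_vertices W S) (comb_edges F S))"
  unfolding algebraically_closed_def
proof (intro allI impI)
  fix A :: "('a + nat \<times> bool) set" assume A: "finite A \<and> A \<subseteq> comb_vertices W S"
  define I where "I = {m. \<exists>b. Inr (m, b) \<in> A}"
  have "I \<subseteq> (fst \<circ> projr) ` A" by (force simp: I_def)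
  then have "finite I" using A finite_subset by blast
  then obtain n where n: "\<forall>m\<in>I. m < n" using finite_nat_set_iff_bounded by blast
  \<comment> \<open>All positions in \<open>A\<close> are below \<open>n\<close>. The ray vertex at
    \<open>Suc n\<close> has neighbours at positions \<open>n\<close> and above only, so it is a
    common neighbour in the complement.\<close>
  have "(Inr (Suc n, False), a) \<notin> comb_edges F S \<and> a \<noteq> Inr (Suc n, False)" if "a \<in> A" for a
  proof -
    have "m < n" if "a = Inr (m, b)" for m b using n that \<open>a \<in> A\<close> by (auto simp: I_def)
    then show ?thesis by (force simp: comb_edges_def)
  qed
  then show "\<exists>w\<in>comb_vertices W S. \<forall>a\<in>A.
      (w, a) \<in> complement_edges (comb_vertices W S) (comb_edges F S)"
    using A by (intro bexI[of _ "Inr (Suc n, False)"]) (auto simp: complement_edges_def comb_vertices_def)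
qed

text \<open>Applying \<open>comb_edges_isomorphism\<close> with both sets equal shows that
  automorphisms fix the comb pointwise, hence permute the vertices from \<open>W\<close>. The map
  \<open>k\<close> restricts to these and \<open>h\<close> extends by the identity on the
  comb.\<close>

lemma Aut_comb_edges:
  assumes F: "F \<subseteq> W \<times> W" and none: "\<And>r l. \<not> comb F S r l" and S: "0 \<notin> S" "1 \<notin> S"
  shows "Aut_graph (comb_vertices W S) (comb_edges F S) \<cong> Aut_graph W F"
proof -
  let ?X = "comb_vertices W S" and ?E = "comb_edges F S"
  define h where "h \<beta> = (\<lambda>z\<in>?X. case z of Inl w \<Rightarrow> Inl (\<beta> w) | Inr p \<Rightarrow> Inr p)" for \<beta> :: "'a \<Rightarrow> 'a"
  define k where "k \<alpha> = (\<lambda>w\<in>W. projl (\<alpha> (Inl w)))" for \<alpha> :: "'a + nat \<times> bool \<Rightarrow> 'a + nat \<times> bool"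
  have IX: "Inl w \<in> ?X \<longleftrightarrow> w \<in> W" for w by (auto simp: comb_vertices_def)
  have EI: "(Inl x, Inl y) \<in> ?E \<longleftrightarrow> (x, y) \<in> F" "(Inl x, Inr p) \<notin> ?E" "(Inr p, Inl x) \<notin> ?E" for x y p
    by (auto simp: comb_edges_def)
  have W: "\<beta> w \<in> W" if "\<beta> \<in> carrier (Aut_graph W F)" "w \<in> W" for \<beta> w
    using that by (auto simp: carrier_Aut_graph_iff graph_isomorphism_def dest: bij_betwE)
  have hc: "h \<beta> \<in> carrier (Aut_graph ?X ?E)" if \<beta>: "\<beta> \<in> carrier (Aut_graph W F)" for \<beta>
  proof -
    have inj: "inj_on \<beta> W" and im: "\<beta> ` W = W"
      and e: "\<And>x y. x \<in> W \<Longrightarrow> y \<in> W \<Longrightarrow> (x, y) \<in> F \<longleftrightarrow> (\<beta> x, \<beta> y) \<in> F"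
      using \<beta> by (auto simp: carrier_Aut_graph_iff graph_isomorphism_def bij_betw_def)
    have "inj_on (h \<beta>) ?X"
    proof (rule inj_onI)
      fix x y assume "x \<in> ?X" "y \<in> ?X" "h \<beta> x = h \<beta> y"
      then show "x = y" using inj by (cases x; cases y) (auto simp: h_def IX dest: inj_onD)
    qed
    moreover have "h \<beta> ` ?X = ?X"
    proof
      show "h \<beta> ` ?X \<subseteq> ?X" using W[OF \<beta>] by (auto simp: h_def IX split: sum.splits)
      show "?X \<subseteq> h \<beta> ` ?X"
      proof
        fix z assume z: "z \<in> ?X"
        show "z \<in> h \<beta> ` ?X"
        proof (cases z)
          case (Inl w)
          then obtain w' where "w' \<in> W" "w = \<beta> w'" using z im by (auto simp: IX)
          then show ?thesis using Inl by (intro image_eqI[of _ _ "Inl w'"]) (auto simp: h_def IX)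
        next
          case (Inr p)
          then show ?thesis using z by (intro image_eqI[of _ _ z]) (auto simp: h_def)
        qed
      qed
    qed
    moreover have "(x, y) \<in> ?E \<longleftrightarrow> (h \<beta> x, h \<beta> y) \<in> ?E" if "x \<in> ?X" "y \<in> ?X" for x y
      using that e by (cases x; cases y) (auto simp: h_def IX EI)
    ultimately show ?thesis
      by (simp add: carrier_Aut_graph_iff graph_isomorphism_def bij_betw_def) (simp add: h_def)
  qed
  have K: "k \<alpha> \<in> carrier (Aut_graph W F) \<and> h (k \<alpha>) = \<alpha>" if \<alpha>: "\<alpha> \<in> carrier (Aut_graph ?X ?E)" for \<alpha>
  proof -
    have iso: "graph_isomorphism ?X ?E ?X ?E \<alpha>" and ext: "\<alpha> \<in> extensional ?X"
      using \<alpha> by (auto simp: carrier_Aut_graph_iff)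
    then have inj: "inj_on \<alpha> ?X" and im: "\<alpha> ` ?X = ?X"
      and e: "\<And>x y. x \<in> ?X \<Longrightarrow> y \<in> ?X \<Longrightarrow> (x, y) \<in> ?E \<longleftrightarrow> (\<alpha> x, \<alpha> y) \<in> ?E"
      by (auto simp: graph_isomorphism_def bij_betw_def)
    have fix_Inr: "\<alpha> (Inr p) = Inr p" if "Inr p \<in> ?X" for p
      using comb_edges_isomorphism(2)[OF F none S S(1) iso that] .
    have k: "\<alpha> (Inl w) = Inl (k \<alpha> w) \<and> k \<alpha> w \<in> W" if w: "w \<in> W" for w
    proof (cases "\<alpha> (Inl w)")
      case (Inl w')
      moreover have "\<alpha> (Inl w) \<in> ?X" using im w IX by blast
      ultimately show ?thesis using w by (simp add: k_def IX)
    next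
      case (Inr p)
      then have "Inr p \<in> ?X" using im w IX by (metis imageI)
      then have "Inr p = Inl w" using fix_Inr[of p] Inr inj w IX by (metis inj_onD)
      then show ?thesis by simp
    qed
    have "inj_on (k \<alpha>) W"
    proof (rule inj_onI)
      fix x y assume xy: "x \<in> W" "y \<in> W" "k \<alpha> x = k \<alpha> y"
      then have "\<alpha> (Inl x) = \<alpha> (Inl y)" using k[of x] k[of y] by simp
      then have "Inl x = (Inl y :: 'a + nat \<times> bool)"
        by (rule inj_onD[OF inj]) (use xy in \<open>simp_all add: IX\<close>)
      then show "x = y" by simp
    qed
    moreover have "k \<alpha> ` W = W"
    proof
      show "k \<alpha> ` W \<subseteq> W" using k by auto
      show "W \<subseteq> k \<alpha> ` W"
      proof
        fix w assume "w \<in> W"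
        then obtain z where z: "z \<in> ?X" "\<alpha> z = Inl w" using im IX by (metis imageE)
        then obtain x where "z = Inl x" using fix_Inr by (cases z) auto
        then show "w \<in> k \<alpha> ` W" using z k IX by (metis imageI sum.inject(1))
      qed
    qed
    moreover have "(x, y) \<in> F \<longleftrightarrow> (k \<alpha> x, k \<alpha> y) \<in> F" if "x \<in> W" "y \<in> W" for x y
      using e[of "Inl x" "Inl y"] that k IX EI by metis
    ultimately have "k \<alpha> \<in> carrier (Aut_graph W F)"
      by (simp add: carrier_Aut_graph_iff graph_isomorphism_def bij_betw_def) (simp add: k_def)
    moreover have "h (k \<alpha>) = \<alpha>"
    proof (rule extensionalityI[of _ ?X])
      show "h (k \<alpha>) z = \<alpha> z" if "z \<in> ?X" for z
        using that k fix_Inr by (cases z) (auto simp: h_def IX)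
    qed (use ext in \<open>auto simp: h_def\<close>)
    ultimately show ?thesis ..
  qed
  have kh: "k (h \<beta>) = \<beta>" if "\<beta> \<in> carrier (Aut_graph W F)" for \<beta>
    using that by (intro extensionalityI[of _ W]) (auto simp: h_def k_def IX carrier_Aut_graph_iff)
  have "bij_betw k (carrier (Aut_graph ?X ?E)) (carrier (Aut_graph W F))"
    by (rule bij_betw_byWitness[where f' = h]) (use hc K kh in auto)
  moreover have "k (f \<otimes>\<^bsub>Aut_graph ?X ?E\<^esub> g) = k f \<otimes>\<^bsub>Aut_graph W F\<^esub> k g"
    if f: "f \<in> carrier (Aut_graph ?X ?E)" for f g
  proof (rule ext)
    fix w
    have "f (Inl w) = Inl (k f w)" if "w \<in> W"
    proof -
      have "f (Inl w) = h (k f) (Inl w)" using K[OF f] by simp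
      then show ?thesis using that by (simp add: h_def IX)
    qed
    then show "k (f \<otimes>\<^bsub>Aut_graph ?X ?E\<^esub> g) w = (k f \<otimes>\<^bsub>Aut_graph W F\<^esub> k g) w"
      using W[of "k f" w] K[OF f] unfolding mult_Aut_graph
      by (cases "w \<in> W") (simp_all add: compose_def IX k_def)
  qed
  ultimately have "k \<in> iso (Aut_graph ?X ?E) (Aut_graph W F)"
    using K by (auto simp: iso_def hom_def)
  then show ?thesis by (rule is_isoI)
qed

lemma Aut_graph_complement:
  "irrefl E \<Longrightarrow> Aut_graph V (complement_edges V E) = Aut_graph V E"
  using graph_isomorphism_complement[of E E V V]
  by (simp add: Aut_graph_def graph_isomorphism_def)

text \<open>One \<open>A\<close> is fixed for which no \<open>pair_code A B\<close> occurs in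
  \<open>F\<close>. An isomorphism of complements is one of the comb graphs themselves, from which
  the code, and so \<open>B\<close>, is recovered.\<close>

lemma many_algebraically_closed_graphs:
  fixes W :: "'b set"
  assumes W: "graph W F" "countable W"
  obtains X :: "nat set \<Rightarrow> ('b + nat \<times> bool) set" and C where
    "\<And>B. graph (X B) (C B)" "\<And>B. countable (X B)" "\<And>B. algebraically_closed (X B) (C B)"
    "\<And>B. Aut_graph (X B) (C B) \<cong> Aut_graph W F"
    "\<And>A B \<alpha>. graph_isomorphism (X A) (C A) (X B) (C B) \<alpha> \<Longrightarrow> A = B"
proof -
  have F: "F \<subseteq> W \<times> W" "irrefl F" using W by (auto simp: graph_def)
  obtain A where A: "\<And>B r l. \<not> comb F (pair_code A B) r l"
    using ex_combs_avoiding[OF W(2) F(1)] by metis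
  define X where "X B = comb_vertices W (pair_code A B)" for B
  define C where "C B = complement_edges (X B) (comb_edges F (pair_code A B))" for B
  show ?thesis
  proof
    show "graph (X B) (C B)" for B
      unfolding X_def C_def by (rule complement_comb_graph[OF W(1)])
    show "countable (X B)" for B
      using W(2) by (simp add: X_def comb_vertices_def)
    show "algebraically_closed (X B) (C B)" for B
      unfolding X_def C_def by (rule complement_comb_algebraically_closed)
    show "Aut_graph (X B) (C B) \<cong> Aut_graph W F" for B
      unfolding X_def C_def Aut_graph_complement[OF comb_edges_irrefl[OF F(2)]]
      by (rule Aut_comb_edges[OF F(1) A pair_code_small])
    show "B = B'" if "graph_isomorphism (X B) (C B) (X B') (C B') \<alpha>" for B B' \<alpha>
    proof -
      have "graph_isomorphism (X B) (comb_edges F (pair_code A B))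
          (X B') (comb_edges F (pair_code A B')) \<alpha>"
        using that F(2) by (simp add: C_def graph_isomorphism_complement comb_edges_irrefl)
      then have "pair_code A B = pair_code A B'"
        unfolding X_def using comb_edges_isomorphism(1)[OF F(1) A] pair_code_small by metis
      then show ?thesis by (simp add: pair_code_eq_iff)
    qed
  qed
qed

section \<open>Counting classes\<close>

text \<open>An endomorphism is recorded as a set of naturals by encoding the pairs in its
  graph.\<close>

lemma End_graph_lepoll:
  fixes V :: "'a set"
  assumes "countable V"
  shows "carrier (End_graph V E) \<lesssim> (UNIV :: nat set set)"
proof -
  let ?n = "to_nat_on V"
  define code where "code f = {prod_encode (?n x, ?n (f x)) |x. x \<in> V}" for f :: "'a \<Rightarrow> 'a"
  have "inj_on code (carrier (End_graph V E))"
  proof (rule inj_onI)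
    fix f g assume f: "f \<in> carrier (End_graph V E)" and g: "g \<in> carrier (End_graph V E)"
      and eq: "code f = code g"
    show "f = g"
    proof (rule End_graph_eqI[OF f g])
      fix x assume x: "x \<in> V"
      then have "prod_encode (?n x, ?n (f x)) \<in> code g"
        by (simp only: eq[symmetric]) (auto simp: code_def)
      then obtain y where y: "y \<in> V" "?n x = ?n y" "?n (f x) = ?n (g y)" by (auto simp: code_def)
      moreover have "x = y" using y x assms by simp
      ultimately show "f x = g x"
        using x assms End_graph_apply_closed[OF f] End_graph_apply_closed[OF g] by simp
    qed
  qed
  then show ?thesis by (auto simp: lepoll_def)
qed

text \<open>Schroeder-Bernstein in the form common to both counts: classes are images of monoid
  elements, and an injective family of classes indexed by sets of naturals gives the lower
  bound.\<close>

lemma classes_eqpoll: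
  assumes "carrier M \<lesssim> (UNIV :: nat set set)" "A \<subseteq> c ` carrier M"
    and "inj_on d (UNIV :: nat set set)" "range d \<subseteq> A"
  shows "A \<approx> (UNIV :: nat set set)"
proof (rule lepoll_antisym)
  show "A \<lesssim> (UNIV :: nat set set)"
    using assms(1,2) image_lepoll lepoll_trans subset_imp_lepoll by metis
  show "(UNIV :: nat set set) \<lesssim> A"
    using assms(3,4) by (auto simp: lepoll_def)
qed

text \<open>A \<D>-class determines the images of its members up to isomorphism. Non-isomorphic
  retracts therefore give distinct classes, and every idempotent of one class has the same group up
  to isomorphism.\<close>

lemma regular_D_classes_with_group:
  fixes V :: "'a set" and W :: "'b set"
  assumes R: "countable_universal_graph V E" and W: "graph W F" "countable W"
  shows "{D \<in> regular_D_classes (End_graph V E).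
           \<forall>e\<in>D. idempotent_element (End_graph V E) e \<longrightarrow>
             H_group (End_graph V E) e \<cong> Aut_graph W F} \<approx> (UNIV :: nat set set)"
proof -
  let ?M = "End_graph V E"
  interpret monoid ?M by (rule monoid_End_graph)
  have cV: "countable V" using R by (simp add: countable_universal_graph_def)
  obtain X :: "nat set \<Rightarrow> ('b + nat \<times> bool) set" and C where
    X: "\<And>B. graph (X B) (C B)" "\<And>B. countable (X B)" "\<And>B. algebraically_closed (X B) (C B)"
    and Aut: "\<And>B. Aut_graph (X B) (C B) \<cong> Aut_graph W F"
    and noniso: "\<And>A B \<alpha>. graph_isomorphism (X A) (C A) (X B) (C B) \<alpha> \<Longrightarrow> A = B"
    using many_algebraically_closed_graphs[OF W] by metis
  have "\<exists>e \<iota>. idempotent_element ?M e \<and> graph_isomorphism (X B) (C B) (e ` V) E \<iota>" for B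
    using many_retractions[OF R X(1)[of B] X(2)[of B] X(3)[of B]] by metis
  then obtain e \<iota> where e: "\<And>B. idempotent_element ?M (e B)"
    and \<iota>: "\<And>B. graph_isomorphism (X B) (C B) (e B ` V) E (\<iota> B)" by metis
  have ec: "e B \<in> carrier ?M" for B using e by (simp add: idempotent_element_def)
  show ?thesis
  proof (rule classes_eqpoll)
    show "carrier ?M \<lesssim> (UNIV :: nat set set)" by (rule End_graph_lepoll[OF cV])
    show "{D \<in> regular_D_classes ?M. \<forall>e\<in>D. idempotent_element ?M e \<longrightarrow>
             H_group ?M e \<cong> Aut_graph W F} \<subseteq> (\<lambda>e. green_D ?M `` {e}) ` carrier ?M"
      by (auto simp: regular_D_classes_def quotient_def)
    show "inj (\<lambda>B. green_D ?M `` {e B})"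
    proof (rule injI)
      fix A B assume "green_D ?M `` {e A} = green_D ?M `` {e B}"
      then have "(e A, e B) \<in> green_D ?M" using green_refl(4)[OF ec[of B]] by blast
      then obtain \<phi> where "graph_isomorphism (e A ` V) E (e B ` V) E \<phi>"
        by (rule green_D_End_graph_image_isomorphism)
      then show "A = B"
        using \<iota> noniso graph_isomorphism_comp graph_isomorphism_inv_into by metis
    qed
    show "range (\<lambda>B. green_D ?M `` {e B}) \<subseteq> {D \<in> regular_D_classes ?M.
        \<forall>e\<in>D. idempotent_element ?M e \<longrightarrow> H_group ?M e \<cong> Aut_graph W F}"
    proof clarify
      fix B
      have "green_D ?M `` {e B} \<in> regular_D_classes ?M"
        using ec[of B] regular_element_green_D_idempotent[OF e]
        by (auto simp: regular_D_classes_def quotient_def)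
      moreover have "H_group ?M f \<cong> Aut_graph W F"
        if f: "(e B, f) \<in> green_D ?M" "idempotent_element ?M f" for f
      proof -
        obtain \<phi> where "graph_isomorphism (e B ` V) E (f ` V) E \<phi>"
          using f(1) by (rule green_D_End_graph_image_isomorphism)
        then have "graph_isomorphism (f ` V) E (X B) (C B) (inv_into (X B) (\<phi> \<circ> \<iota> B))"
          by (intro graph_isomorphism_inv_into graph_isomorphism_comp[OF \<iota>])
        then show ?thesis
          using H_group_End_graph_isomorphic[OF f(2)] Aut_graph_isomorphic Aut iso_trans by metis
      qed
      ultimately show "green_D ?M `` {e B} \<in> regular_D_classes ?M \<and>
          (\<forall>f\<in>green_D ?M `` {e B}. idempotent_element ?M f \<longrightarrow> H_group ?M f \<cong> Aut_graph W F)"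
        by blast
    qed
  qed
qed

text \<open>The image of an idempotent of \<open>D\<close> is itself a countable algebraically
  closed graph. It is embedded anew as \<open>J\<close>, and the retractions onto \<open>J\<close>
  all lie in \<open>D\<close>.\<close>

lemma group_H_classes_in_regular_D_class:
  fixes V :: "'a set"
  assumes R: "countable_universal_graph V E" and D: "D \<in> regular_D_classes (End_graph V E)"
  shows "{H \<in> group_H_classes (End_graph V E). H \<subseteq> D} \<approx> (UNIV :: nat set set)"
proof -
  let ?M = "End_graph V E"
  interpret monoid ?M by (rule monoid_End_graph)
  have cV: "countable V" using R by (simp add: countable_universal_graph_def)
  obtain f where f: "f \<in> carrier ?M" "D = green_D ?M `` {f}" and reg: "\<forall>g\<in>D. regular_element ?M g"
    using D by (auto simp: regular_D_classes_def quotient_def)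
  have "regular_element ?M f" using reg f green_refl(4) by blast
  then obtain e where e: "idempotent_element ?M e" "(f, e) \<in> green_L ?M"
    by (rule regular_element_green_L_idempotent)
  let ?I = "e ` V"
  obtain J \<iota> and \<rho> :: "nat set \<Rightarrow> 'a \<Rightarrow> 'a" where
    \<iota>: "graph_isomorphism ?I (E \<inter> ?I \<times> ?I) J E \<iota>" and inj: "inj \<rho>"
    and \<rho>: "\<And>S. idempotent_element ?M (\<rho> S)" "\<And>S. \<rho> S ` V = J"
    using many_retractions[OF R retract_algebraically_closed(1)[OF R e(1)] countable_image[OF cV]
        retract_algebraically_closed(2)[OF R e(1)]] by metis
  have "graph_isomorphism ?I E J E \<iota>" using \<iota> by (auto simp: graph_isomorphism_def)
  then have iso: "graph_isomorphism (\<rho> S ` V) E ?I E (inv_into ?I \<iota>)" for S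
    unfolding \<rho> by (rule graph_isomorphism_inv_into)
  show ?thesis
  proof (rule classes_eqpoll)
    show "carrier ?M \<lesssim> (UNIV :: nat set set)" by (rule End_graph_lepoll[OF cV])
    show "{H \<in> group_H_classes ?M. H \<subseteq> D} \<subseteq> (\<lambda>e. green_H ?M `` {e}) ` carrier ?M"
      by (auto simp: group_H_classes_def idempotent_element_def)
    show "inj (\<lambda>S. green_H ?M `` {\<rho> S})"
    proof (rule injI)
      fix S T assume "green_H ?M `` {\<rho> S} = green_H ?M `` {\<rho> T}"
      moreover have "(\<rho> T, \<rho> T) \<in> green_H ?M"
        using \<rho>(1)[of T] green_refl(3) by (simp add: idempotent_element_def)
      ultimately have "(\<rho> S, \<rho> T) \<in> green_H ?M" by blast
      then have "\<rho> S = \<rho> T" by (rule idempotent_green_H_unique[OF \<rho>(1) \<rho>(1)])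
      then show "S = T" using inj by (simp add: inj_eq)
    qed
    show "range (\<lambda>S. green_H ?M `` {\<rho> S}) \<subseteq> {H \<in> group_H_classes ?M. H \<subseteq> D}"
    proof -
      have "green_H ?M `` {\<rho> S} \<subseteq> D" for S
      proof
        fix g assume "g \<in> green_H ?M `` {\<rho> S}"
        then have R: "(\<rho> S, g) \<in> green_R ?M" by (simp add: green_H_def)
        \<comment> \<open>This map links the classes: \<open>f\<close>, \<open>e\<close> and
          \<open>?h\<close> are \<L>-related, while \<open>?h\<close>, \<open>\<rho> S\<close> and
          \<open>g\<close> are \<R>-related.\<close>
        let ?h = "\<lambda>x\<in>V. inv_into ?I \<iota> (\<rho> S x)"
        have "(f, ?h) \<in> green_L ?M" "(?h, g) \<in> green_R ?M"
          using idempotents_green_D[OF e(1) \<rho>(1) iso, of S] e(2) R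
          by (auto simp: green_L_def green_R_def)
        then show "g \<in> D" using f(2) by (auto simp: green_D_def)
      qed
      then show ?thesis using \<rho>(1) by (auto simp: group_H_classes_def)
    qed
  qed
qed

theorem theorem3p7:
  fixes V :: "'a set" and E :: "('a \<times> 'a) set"
  assumes "countable_universal_graph V E"
  shows "(\<forall>(W :: 'b set) F. graph W F \<and> countable W \<longrightarrow>
            {D \<in> regular_D_classes (End_graph V E).
               \<forall>e\<in>D. idempotent_element (End_graph V E) e \<longrightarrow>
                 H_group (End_graph V E) e \<cong> Aut_graph W F} \<approx> (UNIV :: nat set set))
       \<and> (\<forall>D \<in> regular_D_classes (End_graph V E).
            {H \<in> group_H_classes (End_graph V E). H \<subseteq> D} \<approx> (UNIV :: nat set set))"
  by (simp add: regular_D_classes_with_group[OF assms] group_H_classes_in_regular_D_class[OF assms])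

end
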